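(* Let $\Phi={}^t(\Phi_1,\Phi_2)$ and $\Omega={}^t(\Omega_1,\Omega_2)$, with $\Phi_j,\Omega_j\in\mathbb{C}^2$, be unit vectors in $\mathbb{C}^4$, and for $(\bm p,\bm q)\in D$ let $U=SC$ be the associated evolution operator on $\ell^2(\mathbb{Z}^2;\mathbb{C}^4)$ (see context). Suppose that: (1) $\Phi_j\cdot(\sigma_1\Omega_j)=0$ for all $j\in\{1,2\}$, and $\langle\Phi_l,\sigma_+\Omega_l\rangle_{\mathbb{C}^2}\neq 0$ for some $l\in\{1,2\}$, which we fix; (2) $a_\Omega(\bm p_0)\neq a_\Phi(\bm p_0)$ for some $\bm p_0\in\{-1,1\}\times\{-1,1\}$, which we fix. Then there exists $\delta>0$ such that for every $(\bm p,\bm q)\in D_l$ with $\|(\bm p,\bm q)-(\bm p_0,\bm 0)\|_{\mathbb{R}^2\times\mathbb{C}^2}<\delta$, the operator $U$ has two eigenvalues in $\{g_-(\lambda),g_+(\lambda)\mid\lambda\in\mathbb{T}_-\}$ or in $\{g_-(\lambda),g_+(\lambda)\mid\lambda\in\mathbb{T}_+\}$.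
   Context: Inner products $\langle\cdot,\cdot\rangle$ are conjugate-linear in the first argument; ${}^*$ on scalars is complex conjugation. For $\Psi={}^t(\psi_1,\psi_2),\Phi={}^t(\phi_1,\phi_2)\in\mathbb{C}^2$, $\Psi\cdot\Phi=\psi_1\phi_1+\psi_2\phi_2$ (bilinear, no conjugation). Matrices: $\sigma_1=\begin{pmatrix}0&1\\1&0\end{pmatrix}$, $\sigma_+=\begin{pmatrix}0&1\\0&0\end{pmatrix}$, $\sigma_3=\begin{pmatrix}1&0\\0&-1\end{pmatrix}$. $D=\{(\bm p,\bm q)=(p_1,p_2,q_1,q_2)\in\mathbb{R}^2\times\mathbb{C}^2 : p_j^2+|q_j|^2=1,\ j=1,2\}$ and $D_j=\{(\bm p,\bm q)\in D: p_jq_j\neq 0\}$. Let $\{\bm e_1,\bm e_2\}$ be the standard basis of $\mathbb{Z}^2$. Shift: on $\ell^2(\mathbb{Z}^2;\mathbb{C}^2)$, for $\Psi={}^t(\psi_1,\psi_2)$, $$(S_j\Psi)(\bm x)=\begin{pmatrix}p_j\psi_1(\bm x)+q_j\psi_2(\bm x+\bm e_j)\\ q_j^*\psi_1(\bm x-\bm e_j)-p_j\psi_2(\bm x)\end{pmatrix},$$ and $S=S_1\oplus S_2$ on $\ell^2(\mathbb{Z}^2;\mathbb{C}^4)\simeq\ell^2(\mathbb{Z}^2;\mathbb{C}^2)\oplus\ell^2(\mathbb{Z}^2;\mathbb{C}^2)$. Coin: $(C\Psi)(\bm x)=C(\bm x)\Psi(\bm x)$, where each $C(\bm x)\in U(4)$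 is self-adjoint with $\dim\ker(C(\bm x)-1)=1$, $C(\bm x)=C_1$ for $\bm x\neq\bm 0$ and $C(\bm 0)=C_0$; $\Phi$ is a normalized vector in $\ker(C_1-1)$ and $\Omega$ a normalized vector in $\ker(C_0-1)$. Equivalently $C_1=2|\Phi\rangle\langle\Phi|-1$ and $C_0=2|\Omega\rangle\langle\Omega|-1$. Thus $C$ is determined by $\Phi,\Omega$, while $S$ (hence $U=SC$) depends on $(\bm p,\bm q)$. Further notation: $a_\Omega(\bm p)=\sum_{j=1}^2p_j\langle\Omega_j,\sigma_3\Omega_j\rangle_{\mathbb{C}^2}$, $a_\Phi(\bm p)=\sum_{j=1}^2p_j\langle\Phi_j,\sigma_3\Phi_j\rangle_{\mathbb{C}^2}$, $\lambda(\bm q)=2\sum_{j=1}^2|q_j\langle\Phi_j,\sigma_+\Phi_j\rangle_{\mathbb{C}^2}|$, $\mathbb{T}_-=[-1,-\lambda(\bm q)+a_\Phi(\bm p))$, $\mathbb{T}_+=(\lambda(\bm q)+a_\Phi(\bm p),1]$, $g_\pm(\lambda)=e^{\pm i\arccos\lambda}$. *)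

theory Defs
  imports "HOL-Analysis.Analysis"
begin

text \<open>The index type \<^typ>\<open>2\<close> plays the role of \<open>{1, 2}\<close>. The space \<open>\<complex>\<^sup>4 \<simeq> \<complex>\<^sup>2 \<oplus> \<complex>\<^sup>2\<close> is
  rendered as \<^typ>\<open>complex^2^2\<close>, so that \<open>v $ j\<close> is the block \<open>v\<^sub>j \<in> \<complex>\<^sup>2\<close>; its norm is the Euclidean one.
  The lattice \<open>\<int>\<^sup>2\<close> is \<^typ>\<open>int^2\<close>, with standard basis \<^term>\<open>axis j (1::int)\<close>.\<close>

type_synonym C2 = "complex^2"
type_synonym C4 = "complex^2^2"
type_synonym lattice = "int^2"
type_synonym param = "(real^2) \<times> (complex^2)"

definition cinner2 :: "C2 \<Rightarrow> C2 \<Rightarrow> complex" where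
  "cinner2 u v = (\<Sum>i\<in>UNIV. cnj (u $ i) * v $ i)"

definition cinner4 :: "C4 \<Rightarrow> C4 \<Rightarrow> complex" where
  "cinner4 u v = (\<Sum>j\<in>UNIV. cinner2 (u $ j) (v $ j))"

definition bdot :: "C2 \<Rightarrow> C2 \<Rightarrow> complex" where
  "bdot u v = (\<Sum>i\<in>UNIV. u $ i * v $ i)"

definition cscale4 :: "complex \<Rightarrow> C4 \<Rightarrow> C4" where
  "cscale4 z v = (\<chi> j. z *s (v $ j))"

definition sigma1 :: "complex^2^2" where
  "sigma1 = vector [vector [0, 1], vector [1, 0]]"

definition sigma_plus :: "complex^2^2" where
  "sigma_plus = vector [vector [0, 1], vector [0, 0]]"

definition sigma3 :: "complex^2^2" where
  "sigma3 = vector [vector [1, 0], vector [0, -1]]"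

definition D :: "param set" where
  "D = {(p, q). \<forall>j. (p $ j)\<^sup>2 + (cmod (q $ j))\<^sup>2 = 1}"

definition D_at :: "2 \<Rightarrow> param set" where
  "D_at j = {(p, q) \<in> D. complex_of_real (p $ j) * q $ j \<noteq> 0}"

definition ell2 :: "('a \<Rightarrow> 'b::real_normed_vector) set" where
  "ell2 = {\<Psi>. (\<lambda>x. (norm (\<Psi> x))\<^sup>2) summable_on UNIV}"

text \<open>Operators on \<open>\<ell>\<^sup>2\<close> are given as maps on all functions on the lattice; that the evolution
  operator preserves \<^const>\<open>ell2\<close> is shown below.\<close>

definition shift_block :: "param \<Rightarrow> 2 \<Rightarrow> (lattice \<Rightarrow> C2) \<Rightarrow> (lattice \<Rightarrow> C2)" where
  "shift_block pq j \<psi> x = (let p = complex_of_real (fst pq $ j); q = snd pq $ j in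
     vector [p * \<psi> x $ 1 + q * \<psi> (x + axis j 1) $ 2,
             cnj q * \<psi> (x - axis j 1) $ 1 - p * \<psi> x $ 2])"

definition shift :: "param \<Rightarrow> (lattice \<Rightarrow> C4) \<Rightarrow> (lattice \<Rightarrow> C4)" where
  "shift pq \<Psi> x = (\<chi> j. shift_block pq j (\<lambda>y. \<Psi> y $ j) x)"

text \<open>The coin matrix \<open>2 |v\<rangle>\<langle>v| - 1\<close>: for a unit vector \<open>v\<close>, the unique self-adjoint unitary
  whose eigenspace for the eigenvalue \<open>1\<close> is the line spanned by \<open>v\<close>.\<close>

definition coin_matrix :: "C4 \<Rightarrow> C4 \<Rightarrow> C4" where
  "coin_matrix v u = cscale4 (2 * cinner4 v u) v - u"

definition coin :: "C4 \<Rightarrow> C4 \<Rightarrow> (lattice \<Rightarrow> C4) \<Rightarrow> (lattice \<Rightarrow> C4)" where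
  "coin \<Phi> \<Omega> \<Psi> x = coin_matrix (if x = 0 then \<Omega> else \<Phi>) (\<Psi> x)"

definition evolution :: "C4 \<Rightarrow> C4 \<Rightarrow> param \<Rightarrow> (lattice \<Rightarrow> C4) \<Rightarrow> (lattice \<Rightarrow> C4)" where
  "evolution \<Phi> \<Omega> pq = shift pq \<circ> coin \<Phi> \<Omega>"

definition is_eigenvalue :: "((lattice \<Rightarrow> C4) \<Rightarrow> (lattice \<Rightarrow> C4)) \<Rightarrow> complex \<Rightarrow> bool" where
  "is_eigenvalue A z \<longleftrightarrow> (\<exists>\<Psi>\<in>ell2. \<Psi> \<noteq> (\<lambda>x. 0) \<and> A \<Psi> = (\<lambda>x. cscale4 z (\<Psi> x)))"

text \<open>\<open>a_coef v p\<close> is \<open>a\<^sub>v(p)\<close>. The sum is real because \<^const>\<open>sigma3\<close> is Hermitian, so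
  taking \<^const>\<open>Re\<close> only changes the type.\<close>

definition a_coef :: "C4 \<Rightarrow> real^2 \<Rightarrow> real" where
  "a_coef v p = Re (\<Sum>j\<in>UNIV. complex_of_real (p $ j) * cinner2 (v $ j) (sigma3 *v (v $ j)))"

definition band :: "C4 \<Rightarrow> complex^2 \<Rightarrow> real" where
  "band \<Phi> q = 2 * (\<Sum>j\<in>UNIV. cmod (q $ j * cinner2 (\<Phi> $ j) (sigma_plus *v (\<Phi> $ j))))"

definition T_minus :: "C4 \<Rightarrow> param \<Rightarrow> real set" where
  "T_minus \<Phi> pq = {-1 ..< - band \<Phi> (snd pq) + a_coef \<Phi> (fst pq)}"

definition T_plus :: "C4 \<Rightarrow> param \<Rightarrow> real set" where
  "T_plus \<Phi> pq = {band \<Phi> (snd pq) + a_coef \<Phi> (fst pq) <.. 1}"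

definition g_plus :: "real \<Rightarrow> complex" where
  "g_plus t = exp (\<i> * complex_of_real (arccos t))"

definition g_minus :: "real \<Rightarrow> complex" where
  "g_minus t = exp (- \<i> * complex_of_real (arccos t))"

definition arcs :: "real set \<Rightarrow> complex set" where
  "arcs T = g_minus ` T \<union> g_plus ` T"

definition has_two_eigenvalues_in :: "((lattice \<Rightarrow> C4) \<Rightarrow> (lattice \<Rightarrow> C4)) \<Rightarrow> complex set \<Rightarrow> bool" where
  "has_two_eigenvalues_in A X \<longleftrightarrow>
     (\<exists>z\<in>X. \<exists>w\<in>X. z \<noteq> w \<and> is_eigenvalue A z \<and> is_eigenvalue A w)"


lemma coin_matrix_fixed_iff:
  assumes "norm v = 1"
  shows "coin_matrix v u = u \<longleftrightarrow> (\<exists>z. u = cscale4 z v)"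
proof
  assume "coin_matrix v u = u"
  then have "u $ i $ j = cscale4 (cinner4 v u) v $ i $ j" for i j
    by (simp add: coin_matrix_def cscale4_def vec_eq_iff algebra_simps)
  then show "\<exists>z. u = cscale4 z v"
    by (metis vec_eq_iff)
next
  have vv: "cinner4 v v = 1"
  proof -
    have "cinner4 v v = complex_of_real ((norm v)\<^sup>2)"
      by (simp add: cinner4_def cinner2_def norm_vec_def L2_set_def sum_nonneg
          complex_norm_square mult.commute del: of_real_power)
    then show ?thesis using assms by simp
  qed
  assume "\<exists>z. u = cscale4 z v"
  then obtain z where u: "u = cscale4 z v" by blast
  have "cinner4 v u = z * cinner4 v v"
    by (simp add: u cinner4_def cinner2_def cscale4_def sum_distrib_left algebra_simps)
  then show "coin_matrix v u = u"
    by (simp add: vv u coin_matrix_def cscale4_def vec_eq_iff algebra_simps)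
qed

lemma ell2_dominated:
  assumes "(\<lambda>x. f x) summable_on UNIV" and "\<And>x. (norm (\<Psi> x))\<^sup>2 \<le> (f x :: real)"
  shows "\<Psi> \<in> ell2"
  unfolding ell2_def mem_Collect_eq
  by (rule summable_on_comparison_test[OF assms(1)]) (use assms(2) in auto)

lemma ell2_add:
  assumes "f \<in> ell2" "g \<in> ell2" shows "(\<lambda>x. f x + g x) \<in> ell2"
proof (rule ell2_dominated)
  show "(\<lambda>x. 2 * (norm (f x))\<^sup>2 + 2 * (norm (g x))\<^sup>2) summable_on UNIV"
    using assms by (intro summable_on_add summable_on_cmult_right) (auto simp: ell2_def)
  fix x
  have "(norm (f x + g x))\<^sup>2 \<le> (norm (f x) + norm (g x))\<^sup>2"
    by (intro power_mono norm_triangle_ineq) simp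
  also have "\<dots> \<le> 2 * (norm (f x))\<^sup>2 + 2 * (norm (g x))\<^sup>2"
    using sum_squares_bound[of "norm (f x)" "norm (g x)"] by (simp add: power2_sum)
  finally show "(norm (f x + g x))\<^sup>2 \<le> 2 * (norm (f x))\<^sup>2 + 2 * (norm (g x))\<^sup>2" .
qed

lemma ell2_le:
  assumes "f \<in> ell2" and "\<And>x. norm (g x) \<le> c * norm (f x)"
  shows "g \<in> ell2"
proof (rule ell2_dominated)
  show "(\<lambda>x. c\<^sup>2 * (norm (f x))\<^sup>2) summable_on UNIV"
    using assms by (intro summable_on_cmult_right) (auto simp: ell2_def)
  show "(norm (g x))\<^sup>2 \<le> c\<^sup>2 * (norm (f x))\<^sup>2" for x
    using power_mono[OF assms(2)[of x], of 2] by (simp add: power_mult_distrib)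
qed

lemma ell2_translate:
  fixes f :: "'a::group_add \<Rightarrow> 'b::real_normed_vector"
  assumes "f \<in> ell2" shows "(\<lambda>x. f (x + a)) \<in> ell2"
proof -
  have "bij (\<lambda>x. x + a)"
    by (rule bij_betw_byWitness[where f' = "\<lambda>x. x - a"]) auto
  then show ?thesis
    using assms summable_on_reindex_bij_betw[of "\<lambda>x. x + a" UNIV UNIV "\<lambda>x. (norm (f x))\<^sup>2"]
    by (simp add: ell2_def)
qed

lemma ell2_vec:
  fixes f :: "'a \<Rightarrow> ('b::real_normed_vector)^'n"
  assumes "\<And>j. (\<lambda>x. f x $ j) \<in> ell2" shows "f \<in> ell2"
proof (rule ell2_dominated)
  show "(\<lambda>x. \<Sum>j\<in>UNIV. (norm (f x $ j))\<^sup>2) summable_on UNIV"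
  proof -
    have "(\<lambda>x. \<Sum>j\<in>J. (norm (f x $ j))\<^sup>2) summable_on UNIV" if "finite J" for J
      using that assms by induction (auto simp: ell2_def intro: summable_on_add)
    then show ?thesis by simp
  qed
  show "(norm (f x))\<^sup>2 \<le> (\<Sum>j\<in>UNIV. (norm (f x $ j))\<^sup>2)" for x
    by (simp add: norm_vec_def L2_set_def sum_nonneg)
qed

lemma ell2_nth:
  fixes f :: "'a \<Rightarrow> ('b::real_normed_vector)^'n"
  assumes "f \<in> ell2" shows "(\<lambda>x. f x $ j) \<in> ell2"
  by (rule ell2_le[OF assms, where c = 1]) (simp add: Finite_Cartesian_Product.norm_nth_le)

lemma ell2_cmult: "f \<in> ell2 \<Longrightarrow> (\<lambda>x. (c::complex) * f x) \<in> ell2"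
  by (rule ell2_le[where c = "norm c"]) (auto simp: norm_mult)

lemma shift_ell2:
  assumes "\<Psi> \<in> ell2" shows "shift pq \<Psi> \<in> ell2"
proof (rule ell2_vec, rule ell2_vec)
  fix j i :: 2
  have t: "(\<lambda>x. \<Psi> (x + a) $ j $ k) \<in> ell2" for a k
    by (intro ell2_nth ell2_translate assms)
  have 1: "(\<lambda>x. shift pq \<Psi> x $ j $ 1) \<in> ell2"
    unfolding shift_def shift_block_def Let_def
    using ell2_add[OF ell2_cmult[OF t[of 0 1], of "complex_of_real (fst pq $ j)"]
        ell2_cmult[OF t[of "axis j 1" 2], of "snd pq $ j"]] by simp
  have 2: "(\<lambda>x. shift pq \<Psi> x $ j $ 2) \<in> ell2"
    unfolding shift_def shift_block_def Let_def
    using ell2_add[OF ell2_cmult[OF t[of "- axis j 1" 1], of "cnj (snd pq $ j)"]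
        ell2_cmult[OF t[of 0 2], of "- complex_of_real (fst pq $ j)"]] by simp
  show "(\<lambda>x. shift pq \<Psi> x $ j $ i) \<in> ell2"
    using 1 2 exhaust_2[of i] by auto
qed

lemma coin_ell2:
  assumes "\<Psi> \<in> ell2" shows "coin \<Phi> \<Omega> \<Psi> \<in> ell2"
proof -
  have bd: "\<exists>c. \<forall>u. norm (coin_matrix v u) \<le> c * norm u" for v
  proof -
    have "linear (coin_matrix v)"
      by (rule linearI)
        (simp_all add: coin_matrix_def cscale4_def cinner4_def cinner2_def vec_eq_iff
          sum.distrib scaleR_sum_right sum_distrib_left algebra_simps
          scaleR_conv_of_real[where 'a = complex])
    then show ?thesis
      using linear_bounded by blast
  qed
  obtain c1 c2 where c: "\<And>u. norm (coin_matrix \<Omega> u) \<le> c1 * norm u"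
    "\<And>u. norm (coin_matrix \<Phi> u) \<le> c2 * norm u"
    using bd by meson
  have "norm (coin \<Phi> \<Omega> \<Psi> x) \<le> max c1 c2 * norm (\<Psi> x)" for x
    unfolding coin_def using c(1)[of "\<Psi> x"] c(2)[of "\<Psi> x"]
    by (auto intro: order_trans[OF _ mult_right_mono[OF max.cobounded1]]
        order_trans[OF _ mult_right_mono[OF max.cobounded2]])
  then show ?thesis
    using assms by (rule ell2_le[rotated])
qed

lemma evolution_ell2: "\<Psi> \<in> ell2 \<Longrightarrow> evolution \<Phi> \<Omega> pq \<Psi> \<in> ell2"
  by (simp add: evolution_def shift_ell2 coin_ell2)

end

theory Submission
  imports Defs
begin

text \<open>Let \<open>d\<close> send a \<open>\<complex>\<^sup>4\<close>-valued function to its pointwise inner product with the coin vector,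
  so that \<open>C = 2 d* d - 1\<close> and the discriminant \<open>T = d S d*\<close> is a discrete Schroedinger operator on
  \<open>\<ell>\<^sup>2(\<int>\<^sup>2)\<close>. An eigenvalue \<open>t\<close> of \<open>T\<close> with \<open>\<bar>t\<bar> < 1\<close> yields the eigenvalues \<open>exp (\<plusminus> i arccos t)\<close> of
  \<open>U\<close>. After removing phases, \<open>T\<close> is a constant plus nearest-neighbour hopping, except at the origin,
  whose couplings to \<open>e\<^sub>j\<close> and \<open>- e\<^sub>j\<close> are opposite by the first hypothesis. Hence the eigenfunction is
  \<open>\<delta>\<^sub>0\<close> plus a combination of the resolvent of the hopping operator applied to the dipoles
  \<open>\<delta>(e\<^sub>j) - \<delta>(-e\<^sub>j)\<close>. These are odd under reflection and so vanish at the origin, and the eigenvalue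
  problem reduces to one scalar equation \<open>\<mu> = a\<^sub>\<Omega> - a\<^sub>\<Phi> + O(\<bar>q\<bar>\<^sup>2)\<close> for the distance \<open>\<mu>\<close> to the band
  centre, solved by the intermediate value theorem.\<close>

subsection \<open>The resolvent of the hopping operator\<close>

definition hop :: "real^'n \<Rightarrow> (int^'n \<Rightarrow> real) \<Rightarrow> int^'n \<Rightarrow> real" where
  "hop \<alpha> g x = (\<Sum>j\<in>UNIV. \<alpha> $ j * (g (x + axis j 1) + g (x - axis j 1)))"

definition dipole :: "'n \<Rightarrow> int^'n \<Rightarrow> real" where
  "dipole j x = of_bool (x = axis j 1) - of_bool (x = - axis j 1)"

definition reflect :: "'n \<Rightarrow> int^'n \<Rightarrow> int^'n" where
  "reflect j x = (\<chi> i. if i = j then - x $ i else x $ i)"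

text \<open>An \<open>l^1\<close> norm bound stated through finite partial sums, so that it carries
  summability with it and needs no infinite sums.\<close>

definition l1_le :: "('a \<Rightarrow> 'b::real_normed_vector) \<Rightarrow> real \<Rightarrow> bool" where
  "l1_le g B \<longleftrightarrow> (\<forall>F. finite F \<longrightarrow> (\<Sum>x\<in>F. norm (g x)) \<le> B)"

text \<open>For non-negative weights this bounds the norm of \<open>hop \<alpha>\<close> on
  \<open>l^1\<close>; for the weights of the final proof it equals \<open>band\<close>.\<close>

definition bandwidth :: "real^'n \<Rightarrow> real" where
  "bandwidth \<alpha> = 2 * (\<Sum>j\<in>UNIV. \<alpha> $ j)"

text \<open>The Neumann series of \<open>(\<mu> - hop \<alpha>)\<^sup>-\<^sup>1\<close> applied to the dipole.\<close>

definition green :: "real^'n \<Rightarrow> 'n \<Rightarrow> real \<Rightarrow> int^'n \<Rightarrow> real" where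
  "green \<alpha> j \<mu> x = (\<Sum>n. (hop \<alpha> ^^ n) (dipole j) x * (1 / \<mu>) ^ Suc n)"

section \<open>Bounds in \<open>l^1\<close> and convergence of the Neumann series\<close>

lemma l1_leD: "l1_le g B \<Longrightarrow> norm (g x) \<le> B"
  unfolding l1_le_def by (metis finite.emptyI finite_insert sum.empty sum.insert add_0_right empty_iff)

lemma l1_le_translate:
  fixes g :: "'a::group_add \<Rightarrow> 'b::real_normed_vector"
  assumes "l1_le g B" shows "l1_le (\<lambda>x. g (x + a)) B"
  unfolding l1_le_def
proof (intro allI impI)
  fix F :: "'a set" assume "finite F"
  have "(\<Sum>x\<in>F. norm (g (x + a))) = (\<Sum>x\<in>(\<lambda>x. x + a) ` F. norm (g x))"
    by (subst sum.reindex) (auto intro: inj_onI)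
  also have "\<dots> \<le> B"
    using assms \<open>finite F\<close> by (simp add: l1_le_def)
  finally show "(\<Sum>x\<in>F. norm (g (x + a))) \<le> B" .
qed

text \<open>Translations preserve the bound, so the two neighbours along axis \<open>j\<close>
  contribute at most \<open>2 * \<alpha> $ j * B\<close>.\<close>

lemma l1_le_hop:
  fixes \<alpha> :: "real^'n"
  assumes "l1_le g B" and "\<And>j. \<alpha> $ j \<ge> 0"
  shows "l1_le (hop \<alpha> g) (bandwidth \<alpha> * B)"
  unfolding l1_le_def
proof (intro allI impI)
  fix F :: "(int^'n) set" assume F: "finite F"
  have "(\<Sum>x\<in>F. norm (hop \<alpha> g x))
      \<le> (\<Sum>x\<in>F. \<Sum>j\<in>UNIV. \<alpha> $ j * (\<bar>g (x + axis j 1)\<bar> + \<bar>g (x - axis j 1)\<bar>))"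
    unfolding hop_def real_norm_def
    by (intro sum_mono order_trans[OF sum_abs])
      (use assms(2) in \<open>auto simp: abs_mult intro!: mult_left_mono\<close>)
  also have "\<dots> = (\<Sum>j\<in>UNIV. \<alpha> $ j * ((\<Sum>x\<in>F. \<bar>g (x + axis j 1)\<bar>) + (\<Sum>x\<in>F. \<bar>g (x - axis j 1)\<bar>)))"
    by (subst sum.swap) (simp add: sum_distrib_left sum.distrib algebra_simps)
  also have "\<dots> \<le> (\<Sum>j\<in>UNIV. \<alpha> $ j * (B + B))"
    using l1_le_translate[OF assms(1), of "axis j 1" for j]
      l1_le_translate[OF assms(1), of "- axis j 1" for j] F assms(2)
    by (intro sum_mono mult_left_mono add_mono) (auto simp: l1_le_def)
  finally show "(\<Sum>x\<in>F. norm (hop \<alpha> g x)) \<le> bandwidth \<alpha> * B"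
    by (simp add: bandwidth_def sum_distrib_right sum_distrib_left algebra_simps)
qed

lemma l1_le_dipole: "l1_le (dipole j) 2"
  unfolding l1_le_def
proof (intro allI impI)
  fix F :: "(int^'a) set" assume F: "finite F"
  have "(\<Sum>x\<in>F. norm (dipole j x))
      \<le> (\<Sum>x\<in>F. of_bool (x = axis j 1) + of_bool (x = - axis j 1))"
    by (intro sum_mono) (auto simp: dipole_def)
  also have "\<dots> \<le> 2"
    using F by (auto simp: sum.distrib of_bool_def sum.delta)
  finally show "(\<Sum>x\<in>F. norm (dipole j x)) \<le> 2" .
qed

lemma bandwidth_nonneg: "(\<And>j. \<alpha> $ j \<ge> 0) \<Longrightarrow> bandwidth \<alpha> \<ge> 0"
  by (simp add: bandwidth_def sum_nonneg)

lemma l1_le_hop_power: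
  assumes "\<And>j. \<alpha> $ j \<ge> 0"
  shows "l1_le ((hop \<alpha> ^^ n) (dipole j)) (2 * bandwidth \<alpha> ^ n)"
proof (induction n)
  case (Suc n)
  then show ?case
    using l1_le_hop[OF Suc, of \<alpha>] assms by (simp add: algebra_simps)
qed (simp add: l1_le_dipole)

context
  fixes \<alpha> :: "real^'n" and \<mu> :: real
  assumes nonneg: "\<And>j. \<alpha> $ j \<ge> 0" and gap: "bandwidth \<alpha> < \<bar>\<mu>\<bar>"
begin

text \<open>A geometric series of ratio \<open>bandwidth \<alpha> / \<bar>\<mu>\<bar>\<close>, which
  \<open>gap\<close> puts below one. It dominates the Neumann series, even after summing over any
  finite set of sites.\<close>

lemma green_majorant:
  "(\<lambda>n. 2 * bandwidth \<alpha> ^ n * \<bar>1 / \<mu>\<bar> ^ Suc n) sums (2 / (\<bar>\<mu>\<bar> - bandwidth \<alpha>))"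
proof -
  have \<mu>: "\<bar>\<mu>\<bar> > 0" and b: "bandwidth \<alpha> \<ge> 0"
    using gap bandwidth_nonneg[OF nonneg] by auto
  then have "(\<lambda>n. 2 / \<bar>\<mu>\<bar> * (bandwidth \<alpha> / \<bar>\<mu>\<bar>) ^ n) sums (2 / \<bar>\<mu>\<bar> * (1 / (1 - bandwidth \<alpha> / \<bar>\<mu>\<bar>)))"
    using gap by (intro sums_mult geometric_sums) auto
  moreover have "2 / \<bar>\<mu>\<bar> * (1 / (1 - bandwidth \<alpha> / \<bar>\<mu>\<bar>)) = 2 / (\<bar>\<mu>\<bar> - bandwidth \<alpha>)"
    using \<mu> gap by (simp add: field_simps)
  ultimately show ?thesis
    by (simp add: power_divide mult.commute)
qed

lemma sum_green_terms_le:
  assumes "finite F"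
  shows "(\<Sum>x\<in>F. \<bar>(hop \<alpha> ^^ n) (dipole j) x * (1 / \<mu>) ^ Suc n\<bar>)
    \<le> 2 * bandwidth \<alpha> ^ n * \<bar>1 / \<mu>\<bar> ^ Suc n"
proof -
  have "(\<Sum>x\<in>F. \<bar>(hop \<alpha> ^^ n) (dipole j) x * (1 / \<mu>) ^ Suc n\<bar>)
      = (\<Sum>x\<in>F. \<bar>(hop \<alpha> ^^ n) (dipole j) x\<bar>) * \<bar>1 / \<mu>\<bar> ^ Suc n"
    by (simp only: abs_mult power_abs sum_distrib_right)
  also have "\<dots> \<le> 2 * bandwidth \<alpha> ^ n * \<bar>1 / \<mu>\<bar> ^ Suc n"
    using l1_le_hop_power[OF nonneg, of n j] assms
    by (intro mult_right_mono) (auto simp: l1_le_def)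
  finally show ?thesis .
qed

lemma summable_abs_green: "summable (\<lambda>n. \<bar>(hop \<alpha> ^^ n) (dipole j) x * (1 / \<mu>) ^ Suc n\<bar>)"
proof (rule summable_comparison_test')
  show "summable (\<lambda>n. 2 * bandwidth \<alpha> ^ n * \<bar>1 / \<mu>\<bar> ^ Suc n)"
    using green_majorant by (rule sums_summable)
  show "norm \<bar>(hop \<alpha> ^^ n) (dipole j) x * (1 / \<mu>) ^ Suc n\<bar>
      \<le> 2 * bandwidth \<alpha> ^ n * \<bar>1 / \<mu>\<bar> ^ Suc n" for n
    using sum_green_terms_le[of "{x}" n j] by simp
qed

lemma summable_green: "summable (\<lambda>n. (hop \<alpha> ^^ n) (dipole j) x * (1 / \<mu>) ^ Suc n)"
  using summable_abs_green by (rule summable_rabs_cancel)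

text \<open>The finite sum over sites is exchanged with the series, so that the majorant bounds all
  sites at once.\<close>

lemma l1_le_green: "l1_le (green \<alpha> j \<mu>) (2 / (\<bar>\<mu>\<bar> - bandwidth \<alpha>))"
  unfolding l1_le_def
proof (intro allI impI)
  fix F :: "(int^'n) set" assume F: "finite F"
  let ?t = "\<lambda>x n. (hop \<alpha> ^^ n) (dipole j) x * (1 / \<mu>) ^ Suc n"
  have "(\<Sum>x\<in>F. norm (green \<alpha> j \<mu> x)) \<le> (\<Sum>x\<in>F. \<Sum>n. \<bar>?t x n\<bar>)"
    unfolding green_def real_norm_def by (intro sum_mono summable_rabs summable_abs_green)
  also have "\<dots> = (\<Sum>n. \<Sum>x\<in>F. \<bar>?t x n\<bar>)"
    by (intro suminf_sum[symmetric] summable_abs_green)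
  also have "\<dots> \<le> (\<Sum>n. 2 * bandwidth \<alpha> ^ n * \<bar>1 / \<mu>\<bar> ^ Suc n)"
    by (intro suminf_le sum_green_terms_le F summable_sum summable_abs_green
        sums_summable[OF green_majorant])
  finally show "(\<Sum>x\<in>F. norm (green \<alpha> j \<mu> x)) \<le> 2 / (\<bar>\<mu>\<bar> - bandwidth \<alpha>)"
    using green_majorant by (simp add: sums_iff)
qed

text \<open>Applying \<open>hop \<alpha>\<close> to the Neumann series raises its index by one, and
  only the term of index zero is lost.\<close>

lemma hop_green: "hop \<alpha> (green \<alpha> j \<mu>) x = \<mu> * green \<alpha> j \<mu> x - dipole j x"
proof -
  let ?u = "\<lambda>n. (hop \<alpha> ^^ n) (dipole j)"
  have \<mu>: "\<mu> \<noteq> 0"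
    using gap bandwidth_nonneg[OF nonneg] by auto
  have g: "(\<lambda>n. ?u n y * (1 / \<mu>) ^ Suc n) sums green \<alpha> j \<mu> y" for y
    unfolding green_def by (rule summable_sums[OF summable_green])
  have "(\<lambda>n. \<Sum>i\<in>UNIV. \<alpha> $ i * (?u n (x + axis i 1) * (1 / \<mu>) ^ Suc n
      + ?u n (x - axis i 1) * (1 / \<mu>) ^ Suc n)) sums hop \<alpha> (green \<alpha> j \<mu>) x"
    unfolding hop_def[of \<alpha> "green \<alpha> j \<mu>"] by (intro sums_sum sums_mult sums_add g)
  moreover have "(\<Sum>i\<in>UNIV. \<alpha> $ i * (?u n (x + axis i 1) * c + ?u n (x - axis i 1) * c)) = ?u (Suc n) x * c" for n c
    by (simp add: hop_def sum_distrib_right mult.assoc flip: distrib_right)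
  ultimately have "(\<lambda>n. ?u (Suc n) x * (1 / \<mu>) ^ Suc n) sums hop \<alpha> (green \<alpha> j \<mu>) x"
    by (simp only:)
  \<comment> \<open>Undoing the index shift restores the term for \<open>n = 0\<close>, which is
    \<open>dipole j x\<close>.\<close>
  then have "(\<lambda>n. ?u n x * (1 / \<mu>) ^ n) sums (hop \<alpha> (green \<alpha> j \<mu>) x + dipole j x)"
    by (subst (asm) sums_Suc_iff) simp
  moreover have "(\<lambda>n. ?u n x * (1 / \<mu>) ^ n) sums (\<mu> * green \<alpha> j \<mu> x)"
    using sums_mult[OF g, of \<mu> x] \<mu> by (simp add: field_simps)
  ultimately show ?thesis
    using sums_unique2 by fastforce
qed

end

section \<open>Reflection symmetry of the resolvent\<close>

lemma reflect_add: "reflect j (x + y) = reflect j x + reflect j y"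
  and reflect_diff: "reflect j (x - y) = reflect j x - reflect j y"
  by (auto simp: reflect_def vec_eq_iff)

lemma reflect_axis: "reflect j (axis i 1) = (if i = j then - axis i 1 else axis i 1)"
  by (auto simp: reflect_def vec_eq_iff axis_def)

lemma reflect_0: "reflect j 0 = 0"
  by (simp add: reflect_def vec_eq_iff)

lemma reflect_minus: "reflect j (- x) = - reflect j x"
  by (simp add: reflect_def vec_eq_iff)

lemma reflect_reflect: "reflect j (reflect j x) = x"
  by (simp add: reflect_def vec_eq_iff)

lemma dipole_reflect: "dipole j (reflect j x) = - dipole j x"
proof -
  have "reflect j x = y \<longleftrightarrow> x = reflect j y" for y
    using reflect_reflect by metis
  then show ?thesis
    by (simp add: dipole_def reflect_axis reflect_minus)
qed

text \<open>The reflection swaps the two neighbours along axis \<open>j\<close> and respects those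
  along the other axes, and \<open>hop\<close> weighs both neighbours along an axis equally.\<close>

lemma hop_reflect:
  assumes "\<And>x. g (reflect j x) = - g x"
  shows "hop \<alpha> g (reflect j x) = - hop \<alpha> g x"
proof -
  have "g (reflect j x + axis i 1) + g (reflect j x - axis i 1)
      = - (g (x + axis i 1) + g (x - axis i 1))" for i
    using assms[of "x + axis i 1"] assms[of "x - axis i 1"]
    by (cases "i = j") (simp_all add: reflect_add reflect_diff reflect_axis)
  then show ?thesis
    unfolding hop_def sum_negf[symmetric] by (simp only: mult_minus_right)
qed

lemma hop_power_reflect: "(hop \<alpha> ^^ n) (dipole j) (reflect j x) = - (hop \<alpha> ^^ n) (dipole j) x"
  by (induction n arbitrary: x) (simp_all add: dipole_reflect hop_reflect)

lemma green_reflect: 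
  assumes "\<And>j. \<alpha> $ j \<ge> 0" and "bandwidth \<alpha> < \<bar>\<mu>\<bar>"
  shows "green \<alpha> j \<mu> (reflect j x) = - green \<alpha> j \<mu> x"
  unfolding green_def hop_power_reflect
  using suminf_minus[OF summable_green[OF assms]] by simp

text \<open>The origin and the basis vectors other than \<open>axis j 1\<close> are fixed by
  \<open>reflect j\<close>, so an odd function vanishes there. For \<open>green_minus_axis\<close>
  with \<open>i\<close> different from \<open>j\<close> both sides are zero.\<close>

lemma
  assumes "\<And>j. \<alpha> $ j \<ge> 0" and "bandwidth \<alpha> < \<bar>\<mu>\<bar>"
  shows green_0: "green \<alpha> j \<mu> 0 = 0"
    and green_minus_axis: "green \<alpha> j \<mu> (- axis i 1) = - green \<alpha> j \<mu> (axis i 1)"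
    and green_axis: "i \<noteq> j \<Longrightarrow> green \<alpha> j \<mu> (axis i 1) = 0"
proof -
  note r = green_reflect[OF assms, of j]
  show "green \<alpha> j \<mu> 0 = 0"
    using r[of 0] by (simp add: reflect_0)
  show "i \<noteq> j \<Longrightarrow> green \<alpha> j \<mu> (axis i 1) = 0"
    using r[of "axis i 1"] by (simp add: reflect_axis)
  show "green \<alpha> j \<mu> (- axis i 1) = - green \<alpha> j \<mu> (axis i 1)"
    using r[of "axis i 1"] r[of "- axis i 1"] by (auto simp: reflect_axis reflect_minus split: if_splits)
qed

text \<open>The Neumann series is a power series in \<open>1 / \<mu>\<close>, hence continuous
  inside its disc of convergence.\<close>

lemma continuous_on_green:
  assumes "\<And>j. \<alpha> $ j \<ge> 0" and "bandwidth \<alpha> < m"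
  shows "continuous_on {\<mu>. m \<le> \<bar>\<mu>\<bar>} (\<lambda>\<mu>. green \<alpha> j \<mu> x)"
proof -
  let ?c = "\<lambda>n. (hop \<alpha> ^^ n) (dipole j) x"
  \<comment> \<open>An intermediate radius puts every \<open>1 / \<mu>\<close> with
    \<open>m \<le> \<bar>\<mu>\<bar>\<close>, together with a neighbourhood, strictly inside a disc
    where the series converges.\<close>
  obtain m' where m': "bandwidth \<alpha> < m'" "m' < m"
    using dense assms(2) by blast
  have b: "bandwidth \<alpha> \<ge> 0"
    by (rule bandwidth_nonneg[OF assms(1)])
  have pos: "m' > 0" using b m' by simp
  have "summable (\<lambda>n. ?c n * (1 / m') ^ Suc n)"
    using summable_green[OF assms(1), of "m'"] m' by simp
  from summable_mult[OF this, of m'] have s: "summable (\<lambda>n. ?c n * (1 / m') ^ n)"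
    using pos by (simp add: field_simps)
  have "isCont (\<lambda>\<mu>. green \<alpha> j \<mu> x) \<mu>" if "m \<le> \<bar>\<mu>\<bar>" for \<mu>
  proof -
    have \<mu>: "\<mu> \<noteq> 0" using that pos m' by auto
    have small: "norm (1 / \<mu>) < norm (1 / m')"
      using that pos m' by (simp add: field_simps)
    have "isCont (\<lambda>\<mu>. 1 / \<mu>) \<mu>"
      using \<mu> by (intro continuous_intros)
    from isCont_o2[OF this isCont_powser[OF s small]]
    have c: "isCont (\<lambda>\<mu>. (\<Sum>n. ?c n * (1 / \<mu>) ^ n) * (1 / \<mu>)) \<mu>"
      using \<mu> by (intro continuous_intros)
    have "green \<alpha> j \<nu> x = (\<Sum>n. ?c n * (1 / \<nu>) ^ n) * (1 / \<nu>)" if "m' < \<bar>\<nu>\<bar>" for \<nu>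
    proof -
      have "norm (1 / \<nu>) < norm (1 / m')"
        using that pos by (simp add: field_simps)
      from suminf_mult2[OF powser_inside[OF s this], of "1 / \<nu>"]
      show ?thesis
        by (simp add: green_def mult.assoc mult.commute)
    qed
    moreover have "\<forall>\<^sub>F \<nu> in nhds \<mu>. m' < \<bar>\<nu>\<bar>"
      using that m' by (intro eventually_nhds_in_open[of "{\<nu>. m' < \<bar>\<nu>\<bar>}", simplified])
        (auto intro!: open_Collect_less continuous_intros)
    ultimately have "\<forall>\<^sub>F \<nu> in nhds \<mu>. green \<alpha> j \<nu> x = (\<Sum>n. ?c n * (1 / \<nu>) ^ n) * (1 / \<nu>)"
      by (auto elim: eventually_mono)
    from isCont_cong[OF this] c show ?thesis
      by simp
  qed
  then show ?thesis
    by (simp add: continuous_at_imp_continuous_on)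
qed

subsection \<open>Spectral mapping\<close>

definition coin_vec :: "C4 \<Rightarrow> C4 \<Rightarrow> lattice \<Rightarrow> C4" where
  "coin_vec \<Phi> \<Omega> x = (if x = 0 then \<Omega> else \<Phi>)"

definition coin_lift :: "C4 \<Rightarrow> C4 \<Rightarrow> (lattice \<Rightarrow> complex) \<Rightarrow> lattice \<Rightarrow> C4" where
  "coin_lift \<Phi> \<Omega> f x = cscale4 (f x) (coin_vec \<Phi> \<Omega> x)"

text \<open>This is \<open>T = d S d*\<close>, with \<open>coin_lift\<close> in the role of
  \<open>d*\<close>.\<close>

definition discriminant :: "C4 \<Rightarrow> C4 \<Rightarrow> param \<Rightarrow> (lattice \<Rightarrow> complex) \<Rightarrow> lattice \<Rightarrow> complex" where
  "discriminant \<Phi> \<Omega> pq f x = cinner4 (coin_vec \<Phi> \<Omega> x) (shift pq (coin_lift \<Phi> \<Omega> f) x)"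

lemma shift_nth:
  "shift pq \<Psi> x $ j $ 1 = complex_of_real (fst pq $ j) * \<Psi> x $ j $ 1
     + snd pq $ j * \<Psi> (x + axis j 1) $ j $ 2"
  "shift pq \<Psi> x $ j $ 2 = cnj (snd pq $ j) * \<Psi> (x - axis j 1) $ j $ 1
     - complex_of_real (fst pq $ j) * \<Psi> x $ j $ 2"
  by (simp_all add: shift_def shift_block_def Let_def)

lemma C4_eqI:
  assumes "\<And>j. u $ j $ 1 = v $ j $ 1" "\<And>j. u $ j $ 2 = v $ j $ 2"
  shows "(u :: C4) = v"
  using assms by (simp add: vec_eq_iff forall_2)

lemma cscale4_nth [simp]: "cscale4 z v $ j $ i = z * v $ j $ i"
  by (simp add: cscale4_def)

lemma D_sum_squares:
  assumes "pq \<in> D"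
  shows "complex_of_real (fst pq $ j) * complex_of_real (fst pq $ j) + snd pq $ j * cnj (snd pq $ j) = 1"
proof -
  have "(fst pq $ j)\<^sup>2 + (cmod (snd pq $ j))\<^sup>2 = 1"
    using assms by (auto simp: D_def)
  then have "complex_of_real ((fst pq $ j)\<^sup>2 + (cmod (snd pq $ j))\<^sup>2) = 1"
    by simp
  then show ?thesis
    by (simp add: complex_norm_square power2_eq_square del: of_real_mult flip: of_real_mult)
      (simp add: complex_norm_square[symmetric] power2_eq_square)
qed

text \<open>The translations cancel, and each block squares to \<open>p * p + q * cnj q\<close>,
  which is one on \<open>D\<close>.\<close>

lemma shift_shift:
  assumes "pq \<in> D"
  shows "shift pq (shift pq \<Psi>) x = \<Psi> x"
proof (rule C4_eqI)
  fix j
  let ?p = "complex_of_real (fst pq $ j)" and ?q = "snd pq $ j"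
  have "shift pq (shift pq \<Psi>) x $ j $ 1 = (?p * ?p + ?q * cnj ?q) * \<Psi> x $ j $ 1"
    "shift pq (shift pq \<Psi>) x $ j $ 2 = (?p * ?p + ?q * cnj ?q) * \<Psi> x $ j $ 2"
    by (simp_all add: shift_nth algebra_simps)
  then show "shift pq (shift pq \<Psi>) x $ j $ 1 = \<Psi> x $ j $ 1"
    "shift pq (shift pq \<Psi>) x $ j $ 2 = \<Psi> x $ j $ 2"
    using D_sum_squares[OF assms, of j] by simp_all
qed

lemma inner_eq_Re_cinner4: "inner u v = Re (cinner4 u v)"
  by (simp add: inner_vec_def cinner4_def cinner2_def inner_complex_def)

lemma cinner4_self: "cinner4 v v = complex_of_real ((norm v)\<^sup>2)"
  by (simp add: cinner4_def cinner2_def norm_vec_def L2_set_def sum_nonneg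
      complex_norm_square mult.commute del: of_real_power)

lemma cinner4_cscale4: "cinner4 (cscale4 z u) v = cnj z * cinner4 u v"
  "cinner4 u (cscale4 z v) = z * cinner4 u v"
  by (simp_all add: cinner4_def cinner2_def sum_distrib_left mult_ac)

lemma cinner4_diff: "cinner4 u (v - w) = cinner4 u v - cinner4 u w"
  by (simp add: cinner4_def cinner2_def sum_subtractf algebra_simps)

lemma norm_cscale4: "norm (cscale4 z v) = cmod z * norm v"
proof -
  have "complex_of_real ((norm (cscale4 z v))\<^sup>2) = complex_of_real ((cmod z * norm v)\<^sup>2)"
    unfolding cinner4_self[symmetric] cinner4_cscale4
    by (simp add: cinner4_self power_mult_distrib complex_norm_square mult_ac del: of_real_power)
  then show ?thesis
    unfolding of_real_eq_iff by (simp add: power2_eq_iff_nonneg)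
qed

context
  fixes \<Phi> \<Omega> :: C4 and pq :: param and f :: "lattice \<Rightarrow> complex" and \<tau> :: real
  assumes norms: "norm \<Phi> = 1" "norm \<Omega> = 1" and D: "pq \<in> D" and f: "f \<in> ell2"
    and nz: "f \<noteq> (\<lambda>x. 0)"
    and eigen: "\<And>x. discriminant \<Phi> \<Omega> pq f x = of_real \<tau> * f x"
begin

lemma norm_coin_vec: "norm (coin_vec \<Phi> \<Omega> x) = 1"
  using norms by (simp add: coin_vec_def)

lemma norm_coin_lift: "norm (coin_lift \<Phi> \<Omega> f x) = cmod (f x)"
  by (simp add: coin_lift_def norm_cscale4 norm_coin_vec)

lemma coin_lift_ell2: "coin_lift \<Phi> \<Omega> f \<in> ell2"
  using f by (rule ell2_le[where c = 1]) (simp add: norm_coin_lift)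

text \<open>On the span of \<open>a = coin_lift f\<close> and \<open>b = shift a\<close> the evolution acts by \<open>a \<mapsto> b\<close> and
  \<open>b \<mapsto> 2\<tau>b - a\<close>, so \<open>b - wa\<close> is an eigenvector whenever \<open>zw = 1\<close> and \<open>z + w = 2\<tau>\<close>.\<close>

lemma eigenvalue_evolution:
  assumes zw: "z * w = 1" and sum: "z + w = 2 * of_real \<tau>" and w: "w\<^sup>2 \<noteq> 1"
  shows "is_eigenvalue (evolution \<Phi> \<Omega> pq) z"
proof -
  define a where "a = coin_lift \<Phi> \<Omega> f"
  define b where "b = shift pq a"
  define \<Psi> where "\<Psi> = (\<lambda>x. b x - cscale4 w (a x))"
  have sb: "shift pq b x = a x" for x
    by (simp add: b_def shift_shift[OF D])
  have "\<Psi> \<in> ell2"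
  proof -
    have "b \<in> ell2"
      unfolding b_def a_def by (intro shift_ell2 coin_lift_ell2)
    moreover have "(\<lambda>x. cscale4 (- w) (a x)) \<in> ell2"
      unfolding a_def by (rule ell2_le[OF coin_lift_ell2, where c = "cmod w"]) (simp add: norm_cscale4)
    ultimately have "(\<lambda>x. b x + cscale4 (- w) (a x)) \<in> ell2"
      by (rule ell2_add)
    moreover have "(\<lambda>x. b x + cscale4 (- w) (a x)) = \<Psi>"
      by (auto simp: \<Psi>_def vec_eq_iff)
    ultimately show ?thesis by simp
  qed
  moreover have "\<Psi> \<noteq> (\<lambda>x. 0)"
  proof
    assume "\<Psi> = (\<lambda>x. 0)"
    then have ba: "b = (\<lambda>x. cscale4 w (a x))"
      by (auto simp: \<Psi>_def fun_eq_iff)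
    \<comment> \<open>If \<open>b = w a\<close>, applying the involutive shift once more gives
      \<open>a = w^2 a\<close>, against \<open>w^2 \<noteq> 1\<close> and the non-vanishing of
      \<open>f\<close>.\<close>
    have "a x = cscale4 (w\<^sup>2) (a x)" for x
    proof -
      have "a x = shift pq (\<lambda>x. cscale4 w (a x)) x"
        using sb[of x] by (simp add: ba)
      also have "\<dots> = cscale4 w (b x)"
        by (rule C4_eqI) (simp_all add: b_def shift_nth algebra_simps)
      finally show ?thesis
        by (simp add: ba cscale4_def vec_eq_iff power2_eq_square mult.assoc)
    qed
    then have "cmod (f x) = cmod (w\<^sup>2) * cmod (f x)" 
      and *: "cscale4 (1 - w\<^sup>2) (a x) = 0" for x
      by (metis a_def norm_cscale4 norm_coin_lift, simp add: vec_eq_iff cscale4_def left_diff_distrib)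
    have "cmod (1 - w\<^sup>2) * cmod (f x) = 0" for x
      using *[of x] by (metis a_def norm_cscale4 norm_coin_lift norm_zero)
    with w nz show False by auto
  qed
  moreover have "evolution \<Phi> \<Omega> pq \<Psi> = (\<lambda>x. cscale4 z (\<Psi> x))"
  proof -
    \<comment> \<open>Here \<open>C = 2 d* d - 1\<close> is used with \<open>d a = f\<close> and
      \<open>d b = \<tau> f\<close>; the sum \<open>z + w = 2 \<tau>\<close> then leaves the
      coefficient \<open>z\<close> on \<open>a\<close>.\<close>
    have "coin \<Phi> \<Omega> \<Psi> x = cscale4 z (a x) - b x" for x
    proof -
      let ?v = "coin_vec \<Phi> \<Omega> x"
      have "cinner4 ?v (a x) = f x"
        by (simp add: a_def coin_lift_def cinner4_cscale4 cinner4_self norm_coin_vec)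
      moreover have "cinner4 ?v (b x) = of_real \<tau> * f x"
        using eigen[of x] by (simp add: discriminant_def a_def b_def)
      ultimately have "2 * cinner4 ?v (\<Psi> x) = (2 * of_real \<tau>) * f x - 2 * w * f x"
        by (simp add: \<Psi>_def cinner4_diff cinner4_cscale4 algebra_simps)
      then have c: "2 * cinner4 ?v (\<Psi> x) = (z - w) * f x"
        unfolding sum[symmetric] by (simp add: algebra_simps)
      have "coin \<Phi> \<Omega> \<Psi> x = cscale4 ((z - w) * f x) ?v - \<Psi> x"
        unfolding c[symmetric] by (simp add: coin_def coin_matrix_def coin_vec_def)
      then show ?thesis
        by (simp add: \<Psi>_def a_def coin_lift_def vec_eq_iff algebra_simps)
    qed
    then have "coin \<Phi> \<Omega> \<Psi> = (\<lambda>x. cscale4 z (a x) - b x)"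
      by auto
    \<comment> \<open>The shift exchanges \<open>a\<close> and \<open>b\<close>, and
      \<open>z b - a\<close> equals \<open>z (b - w a)\<close> because
      \<open>z * w = 1\<close>.\<close>
    moreover have "shift pq (\<lambda>x. cscale4 z (a x) - b x) x = cscale4 z (\<Psi> x)" for x
    proof -
      have "shift pq (\<lambda>x. cscale4 z (a x) - b x) x = cscale4 z (shift pq a x) - shift pq b x"
        by (rule C4_eqI) (simp_all add: shift_nth algebra_simps)
      also have "\<dots> = cscale4 z (b x) - cscale4 (z * w) (a x)"
        by (simp add: sb zw b_def[symmetric] vec_eq_iff)
      finally show ?thesis
        by (simp add: \<Psi>_def vec_eq_iff algebra_simps)
    qed
    ultimately show ?thesis
      by (auto simp: evolution_def)
  qed
  ultimately show ?thesis
    unfolding is_eigenvalue_def by blast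
qed

end

text \<open>The two numbers are conjugate points of the unit circle with real part \<open>t\<close>;
  strictness of \<open>\<bar>t\<bar> < 1\<close> keeps their imaginary parts away from zero.\<close>

lemma g_plus_minus:
  assumes "\<bar>t\<bar> < 1"
  shows "g_plus t * g_minus t = 1" "g_plus t + g_minus t = 2 * of_real t"
    "(g_plus t)\<^sup>2 \<noteq> 1" "(g_minus t)\<^sup>2 \<noteq> 1" "g_plus t \<noteq> g_minus t"
proof -
  have p: "g_plus t = Complex t (sqrt (1 - t\<^sup>2))" and m: "g_minus t = Complex t (- sqrt (1 - t\<^sup>2))"
    using assms
    by (auto simp: g_plus_def g_minus_def complex_eq_iff exp_eq_polar Re_exp Im_exp
        cos_arccos_abs sin_arccos_abs)
  have pos: "sqrt (1 - t\<^sup>2) > 0"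
    using assms by (simp add: abs_square_less_1)
  show "g_plus t * g_minus t = 1"
    by (simp add: g_plus_def g_minus_def flip: exp_add)
  show "g_plus t + g_minus t = 2 * of_real t"
    by (simp add: p m complex_eq_iff)
  show "g_plus t \<noteq> g_minus t"
    using pos by (simp add: p m)
  show "(g_plus t)\<^sup>2 \<noteq> 1" "(g_minus t)\<^sup>2 \<noteq> 1"
    using pos unfolding power2_eq_1_iff by (auto simp: p m complex_eq_iff)
qed

section \<open>Isometry of the shift and exclusion of the thresholds 1 and -1\<close>

lemma infsum_translate:
  fixes h :: "'a::group_add \<Rightarrow> real"
  shows "(\<Sum>\<^sub>\<infinity>x. h (x + a)) = (\<Sum>\<^sub>\<infinity>x. h x)"
proof -
  have "bij (\<lambda>x. x + a)"
    by (rule bij_betw_byWitness[where f' = "\<lambda>x. x - a"]) auto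
  then show ?thesis
    by (rule infsum_reindex_bij_betw)
qed

lemma C4_norm_square: "(norm (u :: C4))\<^sup>2 = (\<Sum>j\<in>UNIV. (cmod (u $ j $ 1))\<^sup>2 + (cmod (u $ j $ 2))\<^sup>2)"
  by (simp add: norm_vec_def L2_set_def sum_nonneg sum_2)

text \<open>Pairing the first component at \<open>x\<close> with the second one at \<open>x + e\<^sub>j\<close>, the shift acts by a
  unitary matrix at each site.\<close>

lemma shift_isometry:
  assumes "pq \<in> D" and \<Psi>: "\<Psi> \<in> ell2"
  shows "(\<Sum>\<^sub>\<infinity>x. (norm (shift pq \<Psi> x))\<^sup>2) = (\<Sum>\<^sub>\<infinity>x. (norm (\<Psi> x))\<^sup>2)"
proof -
  have summ: "(\<lambda>x. (cmod (\<Xi> x $ j $ i))\<^sup>2) summable_on UNIV" if "\<Xi> \<in> ell2" for \<Xi> :: "lattice \<Rightarrow> C4" and i j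
    using ell2_nth[OF ell2_nth[OF that]] by (simp add: ell2_def)
  have summt: "(\<lambda>x. (cmod (\<Xi> (x + a) $ j $ i))\<^sup>2) summable_on UNIV"
    if "\<Xi> \<in> ell2" for \<Xi> :: "lattice \<Rightarrow> C4" and i j a
    using summ[OF ell2_translate[OF that]] .
  have split: "(\<Sum>\<^sub>\<infinity>x. (norm (\<Xi> x))\<^sup>2)
      = (\<Sum>j\<in>UNIV. \<Sum>\<^sub>\<infinity>x. (cmod (\<Xi> x $ j $ 1))\<^sup>2 + (cmod (\<Xi> (x + axis j 1) $ j $ 2))\<^sup>2)"
    if "\<Xi> \<in> ell2" for \<Xi> :: "lattice \<Rightarrow> C4"
  proof -
    have "(\<Sum>\<^sub>\<infinity>x. (norm (\<Xi> x))\<^sup>2)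
        = (\<Sum>j\<in>UNIV. \<Sum>\<^sub>\<infinity>x. (cmod (\<Xi> x $ j $ 1))\<^sup>2 + (cmod (\<Xi> x $ j $ 2))\<^sup>2)"
      unfolding C4_norm_square sum_2 by (intro infsum_add summable_on_add summ that)
    also have "\<dots> = (\<Sum>j\<in>UNIV. (\<Sum>\<^sub>\<infinity>x. (cmod (\<Xi> x $ j $ 1))\<^sup>2) + (\<Sum>\<^sub>\<infinity>x. (cmod (\<Xi> x $ j $ 2))\<^sup>2))"
      by (intro sum.cong refl infsum_add summ that)
    also have "\<dots> = (\<Sum>j\<in>UNIV. (\<Sum>\<^sub>\<infinity>x. (cmod (\<Xi> x $ j $ 1))\<^sup>2)
        + (\<Sum>\<^sub>\<infinity>x. (cmod (\<Xi> (x + axis j 1) $ j $ 2))\<^sup>2))"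
      using infsum_translate[of "\<lambda>x. (cmod (\<Xi> x $ j $ 2))\<^sup>2" for j] by simp
    also have "\<dots> = (\<Sum>j\<in>UNIV. \<Sum>\<^sub>\<infinity>x. (cmod (\<Xi> x $ j $ 1))\<^sup>2 + (cmod (\<Xi> (x + axis j 1) $ j $ 2))\<^sup>2)"
      by (intro sum.cong refl infsum_add[symmetric] summ summt that)
    finally show ?thesis .
  qed
  have "(cmod (shift pq \<Psi> x $ j $ 1))\<^sup>2 + (cmod (shift pq \<Psi> (x + axis j 1) $ j $ 2))\<^sup>2
      = (cmod (\<Psi> x $ j $ 1))\<^sup>2 + (cmod (\<Psi> (x + axis j 1) $ j $ 2))\<^sup>2" for x j
  proof -
    define p where "p = complex_of_real (fst pq $ j)"
    define q u v where "q = snd pq $ j" and "u = \<Psi> x $ j $ 1" and "v = \<Psi> (x + axis j 1) $ j $ 2"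
    have 1: "p * p + q * cnj q = 1" and [simp]: "cnj p = p"
      using D_sum_squares[OF assms(1), of j] by (simp_all add: p_def q_def)
    have "(p * u + q * v) * cnj (p * u + q * v) + (cnj q * u - p * v) * cnj (cnj q * u - p * v)
        = (p * p + q * cnj q) * (u * cnj u + v * cnj v)"
      by (simp add: algebra_simps)
    then have "complex_of_real ((cmod (p * u + q * v))\<^sup>2 + (cmod (cnj q * u - p * v))\<^sup>2)
        = complex_of_real ((cmod u)\<^sup>2 + (cmod v)\<^sup>2)"
      unfolding of_real_add complex_norm_square 1 by simp
    then show ?thesis
      unfolding of_real_eq_iff by (simp add: shift_nth p_def q_def u_def v_def)
  qed
  then show ?thesis
    unfolding split[OF shift_ell2[OF \<Psi>]] split[OF \<Psi>] by simp
qed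

lemma infsum_pos_of_nonzero:
  fixes h :: "'a \<Rightarrow> real"
  assumes "h summable_on UNIV" and "\<And>x. h x \<ge> 0" and "h x0 \<noteq> 0"
  shows "(\<Sum>\<^sub>\<infinity>x. h x) > 0"
  using assms nonneg_infsum_le_0D[of h UNIV x0] infsum_nonneg[of UNIV h] by force

text \<open>Expands \<open>\<parallel>shift (coin_lift f) - s coin_lift f\<parallel>\<^sup>2 = 2 (1 - s \<tau>) \<parallel>f\<parallel>\<^sup>2\<close>.\<close>

lemma
  assumes norms: "norm \<Phi> = 1" "norm \<Omega> = 1" and D: "pq \<in> D" and f: "f \<in> ell2"
    and nz: "f \<noteq> (\<lambda>x. 0)"
    and eigen: "\<And>x. discriminant \<Phi> \<Omega> pq f x = of_real \<tau> * f x" and s: "s\<^sup>2 = (1::real)"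
  shows discriminant_eigenvalue_le: "s * \<tau> \<le> 1"
    and discriminant_eigenvalue_eq:
      "s * \<tau> = 1 \<Longrightarrow> shift pq (coin_lift \<Phi> \<Omega> f) x = cscale4 (of_real s) (coin_lift \<Phi> \<Omega> f x)"
proof -
  define a where "a = coin_lift \<Phi> \<Omega> f"
  define b where "b = shift pq a"
  define N where "N = (\<Sum>\<^sub>\<infinity>x. (cmod (f x))\<^sup>2)"
  note na = norm_coin_lift[OF norms D f nz eigen, folded a_def]
  have a: "a \<in> ell2"
    unfolding a_def by (rule coin_lift_ell2[OF norms D f nz eigen])
  have b: "b \<in> ell2"
    unfolding b_def by (rule shift_ell2[OF a])
  obtain x0 where "f x0 \<noteq> 0"
    using nz by auto
  then have N: "N > 0"
    unfolding N_def using f by (intro infsum_pos_of_nonzero[of _ x0]) (auto simp: ell2_def)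
  have sc: "cscale4 (of_real r) u = r *\<^sub>R u" for r u
    by (simp add: vec_eq_iff scaleR_conv_of_real[where 'a = complex])
  have "inner (a x) (b x) = \<tau> * (cmod (f x))\<^sup>2" for x
  proof -
    have "cinner4 (a x) (b x) = cnj (f x) * (of_real \<tau> * f x)"
      using eigen[of x] by (simp add: a_def b_def discriminant_def coin_lift_def cinner4_cscale4)
    also have "\<dots> = of_real (\<tau> * (cmod (f x))\<^sup>2)"
      by (simp add: complex_norm_square del: of_real_power)
    finally show ?thesis
      by (simp add: inner_eq_Re_cinner4)
  qed
  \<comment> \<open>The term \<open>norm (b x)\<close> stays as it is at each site; it is traded for
    \<open>f\<close> only after summation, by the isometry of the shift.\<close>
  then have pt: "(norm (b x - s *\<^sub>R a x))\<^sup>2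
      = (norm (b x))\<^sup>2 + (1 - 2 * s * \<tau>) * (cmod (f x))\<^sup>2" for x
    using s by (simp add: power2_norm_eq_inner inner_diff_left inner_diff_right inner_commute
        flip: na) (simp add: power2_norm_eq_inner algebra_simps power2_eq_square)
  have sum: "(\<lambda>x. (norm (b x))\<^sup>2) summable_on UNIV" "(\<lambda>x. (cmod (f x))\<^sup>2) summable_on UNIV"
    using b f by (auto simp: ell2_def)
  have summ: "(\<lambda>x. (norm (b x - s *\<^sub>R a x))\<^sup>2) summable_on UNIV"
    unfolding pt by (intro summable_on_add summable_on_cmult_right sum)
  have "(\<Sum>\<^sub>\<infinity>x. (norm (b x - s *\<^sub>R a x))\<^sup>2) = (\<Sum>\<^sub>\<infinity>x. (norm (b x))\<^sup>2) + (1 - 2 * s * \<tau>) * N"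
    unfolding pt N_def
    by (subst infsum_add[OF sum(1) summable_on_cmult_right[OF sum(2)]]) (simp add: infsum_cmult_right')
  also have "(\<Sum>\<^sub>\<infinity>x. (norm (b x))\<^sup>2) = N"
    unfolding b_def shift_isometry[OF D a] by (simp add: na N_def)
  finally have tot: "(\<Sum>\<^sub>\<infinity>x. (norm (b x - s *\<^sub>R a x))\<^sup>2) = 2 * (1 - s * \<tau>) * N"
    by (simp add: algebra_simps)
  moreover have "(\<Sum>\<^sub>\<infinity>x. (norm (b x - s *\<^sub>R a x))\<^sup>2) \<ge> 0"
    by (intro infsum_nonneg) auto
  ultimately show "s * \<tau> \<le> 1"
    using N by (simp add: zero_le_mult_iff)
  assume "s * \<tau> = 1"
  with tot have "(norm (b x - s *\<^sub>R a x))\<^sup>2 = 0"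
    using summ by (intro nonneg_infsum_le_0D[of _ UNIV]) auto
  then show "shift pq (coin_lift \<Phi> \<Omega> f) x = cscale4 (of_real s) (coin_lift \<Phi> \<Omega> f x)"
    by (simp add: sc a_def b_def)
qed

text \<open>On the line through the origin in direction \<open>e\<^sub>l\<close> the modulus of \<open>f\<close> is geometric with one
  and the same ratio on both sides of the origin, so it cannot decay at both ends.\<close>

lemma coin_lift_not_shift_eigenvector:
  assumes D: "pq \<in> D_at l" and f: "f \<in> ell2" and s: "s\<^sup>2 = (1::real)"
    and nonzero: "\<Phi> $ l $ 1 \<noteq> 0" "\<Phi> $ l $ 2 \<noteq> 0" "\<Omega> $ l $ 1 \<noteq> 0" "\<Omega> $ l $ 2 \<noteq> 0"
    and eq: "\<And>x. shift pq (coin_lift \<Phi> \<Omega> f) x = cscale4 (of_real s) (coin_lift \<Phi> \<Omega> f x)"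
  shows "f 0 = 0"
proof (rule ccontr)
  assume f0: "f 0 \<noteq> 0"
  define p q where "p = fst pq $ l" and "q = snd pq $ l"
  have q: "q \<noteq> 0" and "p\<^sup>2 + (cmod q)\<^sup>2 = 1"
    using D by (auto simp: D_at_def D_def p_def q_def)
  then have "p\<^sup>2 \<noteq> s\<^sup>2" using s by auto
  \<comment> \<open>Since \<open>q\<close> is non-zero, \<open>p\<close> has modulus below one, so
    the recursion has a non-zero coefficient.\<close>
  then have sp: "s - p \<noteq> 0" by auto
  let ?e = "axis l 1 :: lattice"
  have rec: "q * coin_vec \<Phi> \<Omega> (x + ?e) $ l $ 2 * f (x + ?e)
      = of_real (s - p) * coin_vec \<Phi> \<Omega> x $ l $ 1 * f x" for x
    using arg_cong[OF eq[of x], of "\<lambda>v. v $ l $ 1"]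
    by (simp add: shift_nth coin_lift_def p_def q_def algebra_simps)
  define r where "r = cmod (of_real (s - p) * \<Phi> $ l $ 1 / (q * \<Phi> $ l $ 2))"
  have r: "r > 0"
    using q sp nonzero by (simp add: r_def del: of_real_diff)
  \<comment> \<open>The origin is excluded at both ends of the step because the coin vector is
    different there.\<close>
  have step: "cmod (f (x + ?e)) = r * cmod (f x)" if "x \<noteq> 0" "x + ?e \<noteq> 0" for x
  proof -
    have "f (x + ?e) = of_real (s - p) * \<Phi> $ l $ 1 / (q * \<Phi> $ l $ 2) * f x"
      using rec[of x] that q nonzero by (simp add: coin_vec_def field_simps)
    then show ?thesis by (simp only: r_def norm_mult)
  qed
  have ne: "axis l m = (0 :: lattice) \<longleftrightarrow> m = 0" for m :: int
    by (auto simp: axis_eq_0_iff)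
  have ma: "- ?e = axis l (- 1)"
    by (auto simp: axis_def vec_eq_iff)
  have ax: "axis l m + ?e = axis l (m + 1)" for m :: int
    by (auto simp: axis_def vec_eq_iff)
  define u where "u m = cmod (f (axis l m))" for m :: int
  have u: "u (m + 1) = r * u m" if "m \<noteq> 0" "m + 1 \<noteq> 0" for m
    using step[of "axis l m"] that by (simp add: u_def ne ax)
  \<comment> \<open>Square summability of \<open>f\<close> restricted to the line; injectivity of
    \<open>g\<close> makes the sampled sites distinct.\<close>
  have lim: "(\<lambda>n. u (g n)) \<longlonglongrightarrow> 0" if "inj g" for g :: "nat \<Rightarrow> int"
  proof -
    have inj: "inj (\<lambda>n. axis l (g n))"
      using that by (auto simp: inj_def axis_eq_axis)
    have "(\<lambda>x. (cmod (f x))\<^sup>2) summable_on range (\<lambda>n. axis l (g n))"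
      using f by (auto simp: ell2_def intro: summable_on_subset_banach)
    then have "(\<lambda>n. (u (g n))\<^sup>2) summable_on UNIV"
      by (subst (asm) summable_on_reindex[OF inj]) (simp add: o_def u_def)
    then have "(\<lambda>n. (u (g n))\<^sup>2) \<longlonglongrightarrow> 0"
      by (intro summable_LIMSEQ_zero summable_on_imp_summable)
    then show ?thesis
      using tendsto_real_sqrt[of "\<lambda>n. (u (g n))\<^sup>2" 0] by (simp add: u_def)
  qed
  have "u 1 > 0"
    using rec[of 0] f0 q sp nonzero by (auto simp: u_def coin_vec_def ne simp del: of_real_diff)
  \<comment> \<open>The recursion at \<open>- ?e\<close> expresses \<open>f 0\<close> through the
    value at \<open>- ?e\<close>, which therefore cannot vanish.\<close>
  have "u (- 1) > 0"
    using rec[of "- ?e", unfolded left_minus] f0 q sp nonzero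
    by (auto simp: u_def coin_vec_def ma ne simp del: of_real_diff)
  have up: "u (1 + int n) = r ^ n * u 1" for n
  proof (induction n)
    case (Suc n)
    then show ?case using u[of "1 + int n"] by (simp add: algebra_simps)
  qed simp
  have down: "r ^ n * u (- 1 - int n) = u (- 1)" for n
  proof (induction n)
    case (Suc n)
    moreover have "- 1 - int (Suc n) = - 2 - int n"
      by simp
    ultimately show ?case using u[of "- 2 - int n"] by (simp add: mult.assoc mult.left_commute)
  qed simp
  have l1: "(\<lambda>n. u (1 + int n)) \<longlonglongrightarrow> 0" and l2: "(\<lambda>n. u (- 1 - int n)) \<longlonglongrightarrow> 0"
    by (intro lim injI; simp)+
  \<comment> \<open>Decay to the right forces \<open>r < 1\<close>, and then the moduli do not
    decrease to the left.\<close>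
  have "r < 1"
  proof (rule ccontr)
    assume "\<not> r < 1"
    then have "u 1 \<le> u (1 + int n)" for n
      using up[of n] one_le_power[of r n] \<open>u 1 > 0\<close> by simp
    with LIMSEQ_le_const[OF l1, of "u 1"] \<open>u 1 > 0\<close> show False by force
  qed
  moreover have "u (- 1) \<le> u (- 1 - int n)" if "r < 1" for n
  proof -
    have "r ^ n * u (- 1 - int n) \<le> 1 * u (- 1 - int n)"
      using that r by (intro mult_right_mono power_le_one) (auto simp: u_def)
    then show ?thesis using down[of n] by simp
  qed
  ultimately show False
    using LIMSEQ_le_const[OF l2, of "u (- 1)"] \<open>u (- 1) > 0\<close> by force
qed

subsection \<open>The bound state\<close>

lemma a_coef_eq: "a_coef v p = (\<Sum>j\<in>UNIV. p $ j * ((cmod (v $ j $ 1))\<^sup>2 - (cmod (v $ j $ 2))\<^sup>2))"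
proof -
  have "cinner2 w (sigma3 *v w) = of_real ((cmod (w $ 1))\<^sup>2 - (cmod (w $ 2))\<^sup>2)" for w
    unfolding of_real_diff complex_norm_square
    by (simp add: cinner2_def sigma3_def matrix_vector_mult_def sum_2 mult.commute)
  then show ?thesis
    by (simp add: a_coef_def del: of_real_diff flip: of_real_mult)
qed

lemma cinner2_sigma_plus: "cinner2 v (sigma_plus *v w) = cnj (v $ 1) * w $ 2"
  by (simp add: cinner2_def sigma_plus_def matrix_vector_mult_def sum_2)

lemma bdot_sigma1: "bdot v (sigma1 *v w) = v $ 1 * w $ 2 + v $ 2 * w $ 1"
  by (simp add: bdot_def sigma1_def matrix_vector_mult_def sum_2)

lemma cinner4_components:
  "cinner4 u v = (\<Sum>j\<in>UNIV. cnj (u $ j $ 1) * v $ j $ 1 + cnj (u $ j $ 2) * v $ j $ 2)"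
  by (simp add: cinner4_def cinner2_def sum_2)

lemma discriminant_eq:
  fixes \<Phi> \<Omega> pq
  defines "\<xi> \<equiv> coin_vec \<Phi> \<Omega>"
  shows "discriminant \<Phi> \<Omega> pq f x = of_real (a_coef (\<xi> x) (fst pq)) * f x
    + (\<Sum>j\<in>UNIV. snd pq $ j * cnj (\<xi> x $ j $ 1) * \<xi> (x + axis j 1) $ j $ 2 * f (x + axis j 1)
      + cnj (snd pq $ j) * cnj (\<xi> x $ j $ 2) * \<xi> (x - axis j 1) $ j $ 1 * f (x - axis j 1))"
proof -
  have a: "complex_of_real (a_coef (\<xi> x) (fst pq)) = (\<Sum>j\<in>UNIV. complex_of_real (fst pq $ j)
      * (\<xi> x $ j $ 1 * cnj (\<xi> x $ j $ 1) - \<xi> x $ j $ 2 * cnj (\<xi> x $ j $ 2)))"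
    unfolding a_coef_eq of_real_sum of_real_mult of_real_diff complex_norm_square ..
  show ?thesis
    unfolding a sum_distrib_right sum.distrib[symmetric]
    unfolding discriminant_def cinner4_components
    by (intro sum.cong) (simp_all add: shift_nth coin_lift_def algebra_simps flip: \<xi>_def)
qed

text \<open>A plane wave with multiplier \<open>u $ j\<close> along axis \<open>j\<close>; it serves
  as a gauge transformation when the multipliers have modulus one. Integer powers allow for negative
  coordinates.\<close>

definition phase :: "complex^'n \<Rightarrow> int^'n \<Rightarrow> complex" where
  "phase u x = (\<Prod>j\<in>UNIV. u $ j powi (x $ j))"

lemma phase_0: "phase u 0 = 1"
  by (simp add: phase_def)

lemma norm_phase: "(\<And>j. cmod (u $ j) = 1) \<Longrightarrow> cmod (phase u x) = 1"
  by (simp add: phase_def norm_power_int flip: prod_norm)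

lemma
  fixes u :: "complex^'n"
  assumes "\<And>j. cmod (u $ j) = 1"
  shows phase_add_axis: "phase u (x + axis j 1) = u $ j * phase u x"
    and phase_diff_axis: "phase u (x - axis j 1) = cnj (u $ j) * phase u x"
proof -
  have nz: "u $ i \<noteq> 0" for i
    using assms[of i] by auto
  have cnj: "inverse (u $ j) = cnj (u $ j)"
    using assms[of j] by (simp add: inverse_complex_def complex_eq_iff cmod_def)
  have *: "phase u (x + axis j c) = u $ j powi c * phase u x" for c
  proof -
    have "phase u (x + axis j c) = (\<Prod>i\<in>UNIV. (if i = j then u $ i powi c else 1) * u $ i powi (x $ i))"
      unfolding phase_def by (intro prod.cong) (simp_all add: axis_def power_int_add nz)
    then show ?thesis
      by (simp add: prod.distrib phase_def)
  qed
  show "phase u (x + axis j 1) = u $ j * phase u x"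
    using *[of 1] by simp
  have minus: "x - axis j 1 = x + axis j (- 1)"
    by (simp add: vec_eq_iff axis_def)
  show "phase u (x - axis j 1) = cnj (u $ j) * phase u x"
    unfolding minus * by (simp add: power_int_minus cnj)
qed

text \<open>The orthogonality relation makes the two couplings to the origin along one axis equal in
  modulus; the phase that turns the bulk coupling into a positive number also makes them opposite.\<close>

lemma exists_phase:
  fixes q a b c d :: complex
  assumes "a * d + b * c = 0"
  shows "\<exists>u. cmod u = 1 \<and> q * cnj a * b * u = of_real (cmod (q * cnj a * b))
    \<and> q * cnj a * d * u = - cnj (q * cnj c * b * u)"
proof (cases "q * cnj a * b = 0")
  \<comment> \<open>With no bulk coupling the relation makes both couplings to the origin vanish, so
    any phase works.\<close>
  case True
  then have "q * cnj a * d = 0 \<and> q * cnj c * b = 0"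
    using assms by auto
  with True show ?thesis by (intro exI[of _ 1]) auto
next
  case False
  define A where "A = q * cnj a * b"
  define u where "u = of_real (cmod A) / A"
  have A: "A \<noteq> 0" "A * u = of_real (cmod A)"
    using False by (auto simp: A_def u_def)
  have uu: "cmod u = 1"
    using A by (simp add: u_def norm_divide)
  then have ucnj: "u * cnj u = 1"
    by (simp flip: complex_norm_square)
  \<comment> \<open>This combination is chosen so that the vanishing factor
    \<open>a * d + b * c\<close> splits off.\<close>
  have "(q * cnj a * d) * cnj A + cnj (q * cnj c * b) * A = q * cnj q * cnj a * cnj b * (a * d + b * c)"
    by (simp add: A_def algebra_simps)
  then have rel: "(q * cnj a * d) * cnj A = - (cnj (q * cnj c * b) * A)"
    by (simp add: assms eq_neg_iff_add_eq_0)
  have "cnj (A * u) = A * u"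
    unfolding A(2) by simp
  then have "cnj A * cnj u = A * u"
    by (simp only: complex_cnj_mult)
  then have "cnj A = A * u * u"
    using ucnj by (metis mult.assoc mult.commute mult.right_neutral)
  with rel have "A * (q * cnj a * d * u * u + cnj (q * cnj c * b)) = 0"
    by (simp add: algebra_simps)
  then have "q * cnj a * d * u * u = - cnj (q * cnj c * b)"
    using A(1) by (simp add: eq_neg_iff_add_eq_0)
  then have "q * cnj a * d * u * (u * cnj u) = - cnj (q * cnj c * b) * cnj u"
    by (metis mult.assoc)
  then show ?thesis
    using uu A(2) ucnj by (intro exI[of _ u]) (simp add: A_def)
qed

lemma l1_le_imp_ell2:
  assumes "l1_le g B" shows "g \<in> ell2"
proof (rule ell2_dominated)
  have "(\<lambda>x. norm (g x)) summable_on UNIV"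
    using assms by (intro nonneg_bdd_above_summable_on bdd_aboveI[of _ B]) (auto simp: l1_le_def)
  then show "(\<lambda>x. B * norm (g x)) summable_on UNIV"
    by (rule summable_on_cmult_right)
  show "(norm (g x))\<^sup>2 \<le> B * norm (g x)" for x
    using l1_leD[OF assms] by (simp add: power2_eq_square mult_right_mono)
qed

context
  fixes \<Phi> \<Omega> :: C4 and pq :: param and u k :: "complex^2" and \<alpha> :: "real^2" and \<mu> :: real
  assumes unit: "\<And>j. cmod (u $ j) = 1"
    and bulk: "\<And>j. snd pq $ j * cnj (\<Phi> $ j $ 1) * \<Phi> $ j $ 2 * u $ j = of_real (\<alpha> $ j)"
    and out: "\<And>j. snd pq $ j * cnj (\<Omega> $ j $ 1) * \<Phi> $ j $ 2 * u $ j = k $ j"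
    and inw: "\<And>j. snd pq $ j * cnj (\<Phi> $ j $ 1) * \<Omega> $ j $ 2 * u $ j = - cnj (k $ j)"
    and nonneg: "\<And>j. \<alpha> $ j \<ge> 0" and gap: "bandwidth \<alpha> < \<bar>\<mu>\<bar>"
begin

text \<open>The part of the state away from the origin, up to phase: the resolvent applied to the
  dipoles that hopping from \<open>\<delta>\<close>-mass at the origin creates at its
  neighbours.\<close>

definition tail :: "lattice \<Rightarrow> complex" where
  "tail x = (\<Sum>j\<in>UNIV. cnj (k $ j) * of_real (green \<alpha> j \<mu> x))"

definition bound_state :: "lattice \<Rightarrow> complex" where
  "bound_state x = phase u x * (of_bool (x = 0) + tail x)"

lemma tail_0: "tail 0 = 0"
  by (simp add: tail_def green_0[OF nonneg gap])

lemma bound_state_0: "bound_state 0 = 1"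
  by (simp add: bound_state_def phase_0 tail_0)

lemma bound_state_ell2: "bound_state \<in> ell2"
proof -
  have green: "(\<lambda>x. cnj (k $ j) * complex_of_real (green \<alpha> j \<mu> x)) \<in> ell2" for j
    by (rule ell2_le[OF l1_le_imp_ell2[OF l1_le_green[OF nonneg gap, of j]], where c = "cmod (k $ j)"])
      (simp add: norm_mult)
  have "(\<lambda>x::lattice. of_bool (x = 0) :: complex) \<in> ell2"
  proof (rule l1_le_imp_ell2[of _ 1])
    show "l1_le (\<lambda>x::lattice. of_bool (x = 0) :: complex) 1"
      unfolding l1_le_def
      by (auto simp: of_bool_def if_distrib[where f = norm] sum.delta cong: if_cong)
  qed
  then have "(\<lambda>x. of_bool (x = 0) + tail x) \<in> ell2"
    unfolding tail_def sum_2 by (intro ell2_add green)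
  then show ?thesis
    by (rule ell2_le[where c = 1]) (simp add: bound_state_def norm_mult norm_phase[OF unit])
qed

lemma hop_tail:
  "(\<Sum>j\<in>UNIV. of_real (\<alpha> $ j) * (tail (x + axis j 1) + tail (x - axis j 1)))
    = of_real \<mu> * tail x - (\<Sum>j\<in>UNIV. cnj (k $ j) * of_real (dipole j x))"
proof -
  have "(\<Sum>j\<in>UNIV. of_real (\<alpha> $ j) * (tail (x + axis j 1) + tail (x - axis j 1)))
      = (\<Sum>i\<in>UNIV. cnj (k $ i) * of_real (hop \<alpha> (green \<alpha> i \<mu>) x))"
    by (simp add: tail_def hop_def sum_2 algebra_simps)
  then show ?thesis
    unfolding hop_green[OF nonneg gap]
    by (simp add: tail_def sum_subtractf sum_distrib_left algebra_simps)
qed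

lemma tail_axis:
  "tail (axis j 1) = cnj (k $ j) * of_real (green \<alpha> j \<mu> (axis j 1))"
  "tail (- axis j 1) = - tail (axis j 1)"
proof -
  show "tail (axis j 1) = cnj (k $ j) * of_real (green \<alpha> j \<mu> (axis j 1))"
    unfolding tail_def
    by (subst sum.remove[of _ j]) (auto simp: green_axis[OF nonneg gap])
  show "tail (- axis j 1) = - tail (axis j 1)"
    by (simp add: tail_def green_minus_axis[OF nonneg gap] sum_negf)
qed

text \<open>Away from the origin, hopping from the unit mass at the origin contributes exactly the
  dipole term missing in \<open>hop_tail\<close>. At the origin the neighbours add up to
  \<open>2 * (cmod (k $ j))^2 * green\<close> on each axis, and the equation becomes
  \<open>eq\<close>.\<close>

lemma discriminant_bound_state:
  assumes eq: "\<mu> = a_coef \<Omega> (fst pq) - a_coef \<Phi> (fst pq)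
      + (\<Sum>j\<in>UNIV. 2 * (cmod (k $ j))\<^sup>2 * green \<alpha> j \<mu> (axis j 1))"
  shows "discriminant \<Phi> \<Omega> pq bound_state x = of_real (\<mu> + a_coef \<Phi> (fst pq)) * bound_state x"
proof -
  let ?f = bound_state and ?e = "\<lambda>j. axis j 1 :: lattice" and ?v = "coin_vec \<Phi> \<Omega>" and ?w = "phase u x"
  define R where "R j = snd pq $ j * cnj (?v x $ j $ 1) * ?v (x + ?e j) $ j $ 2 * ?f (x + ?e j)" for j
  define L where "L j = cnj (snd pq $ j) * cnj (?v x $ j $ 2) * ?v (x - ?e j) $ j $ 1 * ?f (x - ?e j)" for j
  have ne: "?e j \<noteq> 0" for j by (simp add: axis_eq_0_iff)
  note disc = discriminant_eq[of \<Phi> \<Omega> pq ?f x, folded R_def L_def]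
  have bulk': "cnj (snd pq $ j) * \<Phi> $ j $ 1 * cnj (\<Phi> $ j $ 2) * cnj (u $ j) = of_real (\<alpha> $ j)" for j
    using arg_cong[OF bulk[of j], of cnj] by simp
  have out': "cnj (snd pq $ j) * \<Omega> $ j $ 1 * cnj (\<Phi> $ j $ 2) * cnj (u $ j) = cnj (k $ j)" for j
    using arg_cong[OF out[of j], of cnj] by simp
  have inw': "cnj (snd pq $ j) * \<Phi> $ j $ 1 * cnj (\<Omega> $ j $ 2) * cnj (u $ j) = - k $ j" for j
    using arg_cong[OF inw[of j], of cnj] by simp
  show ?thesis
  proof (cases "x = 0")
    case True
    have R: "R j = k $ j * tail (?e j)" for j
      using out[of j] unfolding R_def bound_state_def True phase_add_axis[OF unit]
      by (simp add: coin_vec_def ne phase_0 flip: mult.assoc)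
    \<comment> \<open>Two signs cancel: the coupling is opposite to the one in \<open>R\<close>, and
      so is the value of \<open>tail\<close>. The two neighbours thus contribute equally.\<close>
    have L: "L j = k $ j * tail (?e j)" for j
    proof -
      have "L j = (cnj (snd pq $ j) * \<Phi> $ j $ 1 * cnj (\<Omega> $ j $ 2) * cnj (u $ j)) * tail (- ?e j)"
        unfolding L_def bound_state_def True phase_diff_axis[OF unit]
        by (simp add: coin_vec_def ne phase_0 mult_ac)
      then show ?thesis
        unfolding inw' by (simp add: tail_axis)
    qed
    have "R j + L j = of_real (2 * (cmod (k $ j))\<^sup>2 * green \<alpha> j \<mu> (?e j))" for j
      unfolding R L tail_axis of_real_mult complex_norm_square by simp
    then have "discriminant \<Phi> \<Omega> pq ?f x = of_real (a_coef \<Omega> (fst pq)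
        + (\<Sum>j\<in>UNIV. 2 * (cmod (k $ j))\<^sup>2 * green \<alpha> j \<mu> (axis j 1)))"
      unfolding disc by (simp add: True bound_state_0 coin_vec_def)
    moreover have "a_coef \<Omega> (fst pq) + (\<Sum>j\<in>UNIV. 2 * (cmod (k $ j))\<^sup>2 * green \<alpha> j \<mu> (axis j 1))
        = \<mu> + a_coef \<Phi> (fst pq)"
      using eq by linarith
    ultimately show ?thesis
      by (simp only: True bound_state_0 mult_1_right)
  next
    case False
    \<comment> \<open>One formula covers both cases: when the neighbour is the origin,
      \<open>tail\<close> vanishes there and only the unit mass contributes.\<close>
    have R: "R j = ?w * (of_real (\<alpha> $ j) * tail (x + ?e j) - cnj (k $ j) * of_bool (x = - ?e j))" for j
    proof (cases "x = - ?e j")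
      case True
      have "R j = (snd pq $ j * cnj (\<Phi> $ j $ 1) * \<Omega> $ j $ 2 * u $ j) * ?w"
        unfolding R_def bound_state_def phase_add_axis[OF unit]
        using True False by (simp add: coin_vec_def tail_0 mult_ac)
      then show ?thesis
        unfolding inw using True by (simp add: tail_0)
    next
      case nz: False
      then have "x + ?e j \<noteq> 0"
        by (simp add: eq_neg_iff_add_eq_0)
      then have "R j = (snd pq $ j * cnj (\<Phi> $ j $ 1) * \<Phi> $ j $ 2 * u $ j) * (?w * tail (x + ?e j))"
        unfolding R_def bound_state_def phase_add_axis[OF unit]
        using False by (simp add: coin_vec_def mult_ac)
      then show ?thesis
        unfolding bulk using nz by simp
    qed
    have L: "L j = ?w * (of_real (\<alpha> $ j) * tail (x - ?e j) + cnj (k $ j) * of_bool (x = ?e j))" for j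
    proof (cases "x = ?e j")
      case True
      have "L j = (cnj (snd pq $ j) * \<Omega> $ j $ 1 * cnj (\<Phi> $ j $ 2) * cnj (u $ j)) * ?w"
        unfolding L_def bound_state_def phase_diff_axis[OF unit]
        using True False by (simp add: coin_vec_def tail_0 mult_ac)
      then show ?thesis
        unfolding out' using True by (simp add: tail_0)
    next
      case nz: False
      then have "L j = (cnj (snd pq $ j) * \<Phi> $ j $ 1 * cnj (\<Phi> $ j $ 2) * cnj (u $ j)) * (?w * tail (x - ?e j))"
        unfolding L_def bound_state_def phase_diff_axis[OF unit]
        using False by (simp add: coin_vec_def mult_ac)
      then show ?thesis
        unfolding bulk' using nz by simp
    qed
    have "R j + L j = ?w * (of_real (\<alpha> $ j) * (tail (x + ?e j) + tail (x - ?e j))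
        + cnj (k $ j) * of_real (dipole j x))" for j
      unfolding R L dipole_def by (simp add: algebra_simps)
    then have "(\<Sum>j\<in>UNIV. R j + L j) = ?w * (of_real \<mu> * tail x)"
      using hop_tail[of x] by (simp add: sum.distrib flip: sum_distrib_left)
    then show ?thesis
      unfolding disc using False by (simp add: coin_vec_def bound_state_def algebra_simps)
  qed
qed

end

text \<open>Every \<open>\<mu>\<close> within \<open>\<bar>d\<bar> / 2\<close> of \<open>d\<close>
  has modulus at least \<open>\<bar>d\<bar> / 2\<close>, beyond the bandwidth, so the correction is
  continuous there. \<open>small\<close> keeps it below \<open>\<bar>d\<bar> / 2\<close>, and the
  intermediate value theorem applies between the endpoints.\<close>

lemma exists_bound_state_energy:
  fixes \<alpha> c :: "real^'n"
  assumes nonneg: "\<And>j. \<alpha> $ j \<ge> 0" and "\<And>j. c $ j \<ge> 0" and gap: "bandwidth \<alpha> < \<bar>d\<bar> / 2"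
    and small: "(\<Sum>j\<in>UNIV. c $ j) * (2 / (\<bar>d\<bar> / 2 - bandwidth \<alpha>)) \<le> \<bar>d\<bar> / 2"
  shows "\<exists>\<mu>. \<bar>\<mu> - d\<bar> \<le> \<bar>d\<bar> / 2 \<and> \<mu> = d + (\<Sum>j\<in>UNIV. c $ j * green \<alpha> j \<mu> (axis j 1))"
proof -
  define G where "G \<mu> = (\<Sum>j\<in>UNIV. c $ j * green \<alpha> j \<mu> (axis j 1))" for \<mu>
  have bound: "\<bar>G \<mu>\<bar> \<le> \<bar>d\<bar> / 2" if "\<bar>d\<bar> / 2 \<le> \<bar>\<mu>\<bar>" for \<mu>
  proof -
    have \<mu>: "bandwidth \<alpha> < \<bar>\<mu>\<bar>" using gap that by simp
    have "\<bar>G \<mu>\<bar> \<le> (\<Sum>j\<in>UNIV. c $ j * \<bar>green \<alpha> j \<mu> (axis j 1)\<bar>)"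
      unfolding G_def using assms(2) by (intro order_trans[OF sum_abs]) (simp add: abs_mult)
    also have "\<dots> \<le> (\<Sum>j\<in>UNIV. c $ j * (2 / (\<bar>d\<bar> / 2 - bandwidth \<alpha>)))"
    proof (intro sum_mono mult_left_mono assms(2))
      fix j
      have "\<bar>green \<alpha> j \<mu> (axis j 1)\<bar> \<le> 2 / (\<bar>\<mu>\<bar> - bandwidth \<alpha>)"
        using l1_leD[OF l1_le_green[OF nonneg \<mu>]] by simp
      also have "\<dots> \<le> 2 / (\<bar>d\<bar> / 2 - bandwidth \<alpha>)"
        using that gap by (intro divide_left_mono mult_pos_pos) auto
      finally show "\<bar>green \<alpha> j \<mu> (axis j 1)\<bar> \<le> 2 / (\<bar>d\<bar> / 2 - bandwidth \<alpha>)" .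
    qed
    finally show ?thesis
      using small unfolding sum_distrib_right by linarith
  qed
  let ?I = "{d - \<bar>d\<bar> / 2 .. d + \<bar>d\<bar> / 2}"
  have far: "\<bar>d\<bar> / 2 \<le> \<bar>\<mu>\<bar>" if "\<mu> \<in> ?I" for \<mu>
    using that by auto
  have "continuous_on {\<mu>. \<bar>d\<bar> / 2 \<le> \<bar>\<mu>\<bar>} G"
    unfolding G_def by (intro continuous_intros continuous_on_green nonneg gap)
  then have "continuous_on ?I (\<lambda>\<mu>. \<mu> - G \<mu>)"
    using far by (intro continuous_intros) (auto elim: continuous_on_subset)
  moreover have "(d - \<bar>d\<bar> / 2) - G (d - \<bar>d\<bar> / 2) \<le> d" "d \<le> (d + \<bar>d\<bar> / 2) - G (d + \<bar>d\<bar> / 2)"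
    using bound[OF far, of "d - \<bar>d\<bar> / 2"] bound[OF far, of "d + \<bar>d\<bar> / 2"] by auto
  ultimately obtain \<mu> where "\<mu> \<in> ?I" "\<mu> - G \<mu> = d"
    using IVT'[of "\<lambda>\<mu>. \<mu> - G \<mu>" "d - \<bar>d\<bar> / 2" d "d + \<bar>d\<bar> / 2"] by auto
  then show ?thesis
    unfolding G_def by (intro exI[of _ \<mu>]) (auto simp: abs_le_iff)
qed

text \<open>The coefficients of \<open>p\<close> in \<open>a_coef\<close> have absolute values
  summing to at most the squared norm of \<open>v\<close>, which is one.\<close>

lemma a_coef_diff_le:
  assumes "norm v = 1" and "\<And>j. \<bar>p $ j - p' $ j\<bar> \<le> e"
  shows "\<bar>a_coef v p - a_coef v p'\<bar> \<le> e"
proof -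
  have "\<bar>a_coef v p - a_coef v p'\<bar>
      = \<bar>\<Sum>j\<in>UNIV. (p $ j - p' $ j) * ((cmod (v $ j $ 1))\<^sup>2 - (cmod (v $ j $ 2))\<^sup>2)\<bar>"
    by (simp add: a_coef_eq sum_subtractf left_diff_distrib)
  also have "\<dots> \<le> (\<Sum>j\<in>UNIV. e * ((cmod (v $ j $ 1))\<^sup>2 + (cmod (v $ j $ 2))\<^sup>2))"
  proof (intro order_trans[OF sum_abs] sum_mono)
    fix j
    have "\<bar>(cmod (v $ j $ 1))\<^sup>2 - (cmod (v $ j $ 2))\<^sup>2\<bar> \<le> (cmod (v $ j $ 1))\<^sup>2 + (cmod (v $ j $ 2))\<^sup>2"
      by (simp add: abs_le_iff)
    then show "\<bar>(p $ j - p' $ j) * ((cmod (v $ j $ 1))\<^sup>2 - (cmod (v $ j $ 2))\<^sup>2)\<bar>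
        \<le> e * ((cmod (v $ j $ 1))\<^sup>2 + (cmod (v $ j $ 2))\<^sup>2)"
      unfolding abs_mult using assms(2)[of j] by (intro mult_mono) auto
  qed
  also have "\<dots> = e * (norm v)\<^sup>2"
    by (simp add: C4_norm_square sum_distrib_left)
  finally show ?thesis
    using assms(1) by simp
qed

section \<open>From the discriminant to the eigenvalues of the evolution\<close>

lemma has_two_eigenvalues_in_arcs:
  assumes "norm \<Phi> = 1" "norm \<Omega> = 1" "pq \<in> D" "f \<in> ell2" "f \<noteq> (\<lambda>x. 0)"
    and "\<And>x. discriminant \<Phi> \<Omega> pq f x = of_real t * f x" and t: "\<bar>t\<bar> < 1" "t \<in> T"
  shows "has_two_eigenvalues_in (evolution \<Phi> \<Omega> pq) (arcs T)"
  unfolding has_two_eigenvalues_in_def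
proof (intro bexI conjI)
  note g = g_plus_minus[OF t(1)]
  show "g_plus t \<noteq> g_minus t"
    by (rule g)
  show "g_plus t \<in> arcs T" "g_minus t \<in> arcs T"
    using t(2) by (auto simp: arcs_def)
  show "is_eigenvalue (evolution \<Phi> \<Omega> pq) (g_plus t)"
    by (rule eigenvalue_evolution[OF assms(1-6) g(1,2,4)])
  show "is_eigenvalue (evolution \<Phi> \<Omega> pq) (g_minus t)"
    by (rule eigenvalue_evolution[OF assms(1-6) _ _ g(3)]) (use g(1,2) in \<open>simp_all add: ac_simps\<close>)
qed

text \<open>Equality at either threshold would make \<open>coin_lift \<Phi> \<Omega> f\<close> an
  eigenvector of the shift, which forces \<open>f 0 = 0\<close>. The signs \<open>s = 1\<close> and
  \<open>s = - 1\<close> treat the two thresholds.\<close>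

lemma discriminant_eigenvalue_less_1:
  assumes norms: "norm \<Phi> = 1" "norm \<Omega> = 1" and pq: "pq \<in> D_at l" and f: "f \<in> ell2" "f 0 \<noteq> 0"
    and nonzero: "\<Phi> $ l $ 1 \<noteq> 0" "\<Phi> $ l $ 2 \<noteq> 0" "\<Omega> $ l $ 1 \<noteq> 0" "\<Omega> $ l $ 2 \<noteq> 0"
    and eigen: "\<And>x. discriminant \<Phi> \<Omega> pq f x = of_real t * f x"
  shows "\<bar>t\<bar> < 1"
proof -
  have "s * t < 1" if s: "s\<^sup>2 = 1" for s
  proof -
    have D: "pq \<in> D" and nz: "f \<noteq> (\<lambda>x. 0)"
      using pq f by (auto simp: D_at_def)
    have "s * t \<noteq> 1"
    proof
      assume "s * t = 1"
      from coin_lift_not_shift_eigenvector[OF pq f(1) s nonzero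
          discriminant_eigenvalue_eq[OF norms D f(1) nz eigen s this]] f(2)
      show False by simp
    qed
    then show ?thesis
      using discriminant_eigenvalue_le[OF norms D f(1) nz eigen s] by simp
  qed
  from this[of 1] this[of "- 1"] show ?thesis
    by simp
qed

theorem theorem1p1:
  fixes \<Phi> \<Omega> :: C4 and l :: 2 and p0 :: "real^2"
  assumes "norm \<Phi> = 1" and "norm \<Omega> = 1"
    and "\<forall>j. bdot (\<Phi> $ j) (sigma1 *v (\<Omega> $ j)) = 0"
    and "cinner2 (\<Phi> $ l) (sigma_plus *v (\<Omega> $ l)) \<noteq> 0"
    and "\<forall>j. p0 $ j \<in> {-1, 1}"
    and "a_coef \<Omega> p0 \<noteq> a_coef \<Phi> p0"
  shows "\<exists>\<delta>>0. \<forall>pq\<in>D_at l. norm (pq - (p0, 0)) < \<delta> \<longrightarrow>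
    has_two_eigenvalues_in (evolution \<Phi> \<Omega> pq) (arcs (T_minus \<Phi> pq)) \<or>
    has_two_eigenvalues_in (evolution \<Phi> \<Omega> pq) (arcs (T_plus \<Phi> pq))"
proof -
  \<comment> \<open>One hundredth of the separation at \<open>p0\<close>: moving \<open>p\<close>
    costs at most \<open>2 * \<delta>\<close> of it, and the bandwidth is at most
    \<open>4 * \<delta>\<close>.\<close>
  define \<delta> where "\<delta> = \<bar>a_coef \<Omega> p0 - a_coef \<Phi> p0\<bar> / 100"
  have \<delta>: "\<delta> > 0"
    using assms(6) by (simp add: \<delta>_def)
  have ortho: "\<Phi> $ j $ 1 * \<Omega> $ j $ 2 + \<Phi> $ j $ 2 * \<Omega> $ j $ 1 = 0" for j
    using assms(3) by (simp add: bdot_sigma1)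
  \<comment> \<open>The non-zero product of \<open>\<Phi> $ l $ 1\<close> and
    \<open>\<Omega> $ l $ 2\<close> is minus the product of the other two components.\<close>
  have nonzero: "\<Phi> $ l $ 1 \<noteq> 0" "\<Omega> $ l $ 2 \<noteq> 0" "\<Phi> $ l $ 2 \<noteq> 0" "\<Omega> $ l $ 1 \<noteq> 0"
    using assms(4) ortho[of l] by (auto simp: cinner2_sigma_plus)
  have le1: "cmod (v $ j $ i) \<le> 1" if "norm v = 1" for v :: C4 and j i
    using Finite_Cartesian_Product.norm_nth_le[of "v $ j" i] Finite_Cartesian_Product.norm_nth_le[of v j] that by simp
  have "has_two_eigenvalues_in (evolution \<Phi> \<Omega> pq) (arcs (T_minus \<Phi> pq)) \<or>
      has_two_eigenvalues_in (evolution \<Phi> \<Omega> pq) (arcs (T_plus \<Phi> pq))"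
    if pq: "pq \<in> D_at l" and near: "norm (pq - (p0, 0)) < \<delta>" for pq
  proof -
    define p q where "p = fst pq" and "q = snd pq"
    have "pq - (p0, 0) = (p - p0, q)"
      by (simp add: p_def q_def prod_eq_iff)
    then have "norm (p - p0) \<le> \<delta>" "norm q \<le> \<delta>"
      using norm_fst_le[of "p - p0" q] norm_snd_le[of q "p - p0"] near by simp_all
    then have p: "\<bar>p $ j - p0 $ j\<bar> \<le> \<delta>" and q: "cmod (q $ j) \<le> \<delta>" for j
      using component_le_norm_cart[of "p - p0" j] Finite_Cartesian_Product.norm_nth_le[of q j] by auto
    define d where "d = a_coef \<Omega> p - a_coef \<Phi> p"
    have "\<bar>a_coef \<Phi> p - a_coef \<Phi> p0\<bar> \<le> \<delta>" "\<bar>a_coef \<Omega> p - a_coef \<Omega> p0\<bar> \<le> \<delta>"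
      by (rule a_coef_diff_le[OF _ p], fact)+
    moreover have "\<bar>a_coef \<Omega> p0 - a_coef \<Phi> p0\<bar> = 100 * \<delta>"
      by (simp add: \<delta>_def)
    ultimately have d: "\<bar>d\<bar> \<ge> 98 * \<delta>"
      unfolding d_def by linarith
    define \<alpha> :: "real^2" where "\<alpha> = (\<chi> j. cmod (q $ j * cnj (\<Phi> $ j $ 1) * \<Phi> $ j $ 2))"
    have "\<forall>j. \<exists>w. cmod w = 1
        \<and> q $ j * cnj (\<Phi> $ j $ 1) * \<Phi> $ j $ 2 * w = of_real (\<alpha> $ j)
        \<and> q $ j * cnj (\<Phi> $ j $ 1) * \<Omega> $ j $ 2 * w
          = - cnj (q $ j * cnj (\<Omega> $ j $ 1) * \<Phi> $ j $ 2 * w)"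
      using exists_phase[OF ortho] by (simp only: \<alpha>_def vec_lambda_beta) simp
    from choice[OF this] obtain u' where u': "\<And>j. cmod (u' j) = 1
        \<and> q $ j * cnj (\<Phi> $ j $ 1) * \<Phi> $ j $ 2 * u' j = of_real (\<alpha> $ j)
        \<and> q $ j * cnj (\<Phi> $ j $ 1) * \<Omega> $ j $ 2 * u' j
          = - cnj (q $ j * cnj (\<Omega> $ j $ 1) * \<Phi> $ j $ 2 * u' j)"
      by blast
    define u :: "complex^2" where "u = (\<chi> j. u' j)"
    define k :: "complex^2" where "k = (\<chi> j. q $ j * cnj (\<Omega> $ j $ 1) * \<Phi> $ j $ 2 * u' j)"
    have \<alpha>0: "\<alpha> $ j \<ge> 0" for j
      by (simp add: \<alpha>_def)
    have prod_le: "cmod (q $ j * cnj a * b) \<le> \<delta>" if "cmod a \<le> 1" "cmod b \<le> 1" for a b j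
    proof -
      have "cmod (q $ j) * cmod a * cmod b \<le> \<delta> * 1 * 1"
        using that q[of j] \<delta> by (intro mult_mono) auto
      then show ?thesis by (simp add: norm_mult)
    qed
    have \<alpha>1: "\<alpha> $ j \<le> \<delta>" and k1: "cmod (k $ j) \<le> \<delta>" for j
      using prod_le le1 assms(1,2) u'[of j] by (simp_all add: \<alpha>_def k_def norm_mult)
    have band: "bandwidth \<alpha> = band \<Phi> q"
      by (simp add: bandwidth_def band_def \<alpha>_def cinner2_sigma_plus mult.assoc)
    have bw: "bandwidth \<alpha> \<le> 4 * \<delta>"
      using \<alpha>1[of 1] \<alpha>1[of 2] by (simp add: bandwidth_def sum_2)
    define c :: "real^2" where "c = (\<chi> j. 2 * (cmod (k $ j))\<^sup>2)"
    \<comment> \<open>The constant 45 is \<open>98 / 2 - 4\<close>, from the lower bound on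
      \<open>\<bar>d\<bar>\<close> and the upper bound on the bandwidth.\<close>
    have "(\<Sum>j\<in>UNIV. c $ j) * (2 / (\<bar>d\<bar> / 2 - bandwidth \<alpha>)) \<le> (4 * \<delta>\<^sup>2) * (2 / (45 * \<delta>))"
    proof (intro mult_mono divide_left_mono)
      show "(\<Sum>j\<in>UNIV. c $ j) \<le> 4 * \<delta>\<^sup>2"
        using power_mono[OF k1[of 1], of 2] power_mono[OF k1[of 2], of 2] by (simp add: c_def sum_2)
    qed (use bw d \<delta> in auto)
    also have "\<dots> \<le> \<bar>d\<bar> / 2"
      using d \<delta> by (simp add: power2_eq_square)
    finally obtain \<mu> where \<mu>: "\<bar>\<mu> - d\<bar> \<le> \<bar>d\<bar> / 2"
      and eq: "\<mu> = d + (\<Sum>j\<in>UNIV. c $ j * green \<alpha> j \<mu> (axis j 1))"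
      using exists_bound_state_energy[of \<alpha> c d, OF \<alpha>0] bw d \<delta> by (auto simp: c_def)
    have gap: "bandwidth \<alpha> < \<bar>\<mu>\<bar>"
      using \<mu> bw d \<delta> by linarith
    have coup: "cmod (u $ j) = 1"
      "snd pq $ j * cnj (\<Phi> $ j $ 1) * \<Phi> $ j $ 2 * u $ j = of_real (\<alpha> $ j)"
      "snd pq $ j * cnj (\<Omega> $ j $ 1) * \<Phi> $ j $ 2 * u $ j = k $ j"
      "snd pq $ j * cnj (\<Phi> $ j $ 1) * \<Omega> $ j $ 2 * u $ j = - cnj (k $ j)" for j
      using u'[of j] by (simp_all add: u_def k_def q_def)
    define f where "f = bound_state u k \<alpha> \<mu>"
    define t where "t = \<mu> + a_coef \<Phi> p"
    have eigen: "discriminant \<Phi> \<Omega> pq f x = of_real t * f x" for x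
      unfolding f_def t_def p_def
      by (rule discriminant_bound_state[OF coup \<alpha>0 gap])
        (use eq in \<open>simp add: d_def c_def p_def\<close>)
    have f: "f \<in> ell2" and f0: "f 0 \<noteq> 0"
      unfolding f_def using bound_state_ell2[OF coup \<alpha>0 gap] bound_state_0[OF coup \<alpha>0 gap] by auto
    have t: "\<bar>t\<bar> < 1"
      using discriminant_eigenvalue_less_1[OF assms(1,2) pq f f0 _ _ _ _ eigen] nonzero by blast
    have D: "pq \<in> D" and nz: "f \<noteq> (\<lambda>x. 0)"
      using pq f0 by (auto simp: D_at_def)
    note two = has_two_eigenvalues_in_arcs[OF assms(1,2) D f nz eigen t]
    \<comment> \<open>The distance of \<open>t\<close> to the band centre is
      \<open>\<bar>\<mu>\<bar>\<close>, larger than the half-width \<open>band \<Phi> q\<close>; the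
      sign of \<open>\<mu>\<close> selects the side.\<close>
    have "t \<in> T_minus \<Phi> pq \<or> t \<in> T_plus \<Phi> pq"
      using gap t by (auto simp: T_minus_def T_plus_def t_def band p_def q_def)
    then show ?thesis
      using two by blast
  qed
  then show ?thesis
    using \<delta> by blast
qed

end
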